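(* Let $b:\mathbb{R}\to\mathbb{R}$ be locally Lipschitz, nonnegative and nondecreasing, let $\sigma>0$ be a constant, and let $u_0,v_0:\mathbb{R}\to\mathbb{R}$ be continuous, bounded and nonnegative. Consider the stochastic wave equation on the real line $$\frac{\partial^2 u}{\partial t^2}(t,x)=\frac{\partial^2 u}{\partial x^2}(t,x)+\sigma\dot W(t,x)+b(u(t,x)),\quad x\in\mathbb{R},\ t>0,$$ $$u(0,x)=u_0(x),\quad \frac{\partial u}{\partial t}(0,x)=v_0(x),\quad x\in\mathbb{R},$$ where $\dot W$ is space-time Gaussian white noise. Suppose that for some $\alpha>0$ and $\beta>0$ $$\int_\alpha^\infty \frac{1}{\left[\beta^2+2\int_\alpha^s b(r)\,dr\right]^{1/2}}\,ds<\infty .$$ Then, almost surely, there is no global solution to this equation (that is, for any local random field solution on $(0,\tau)$, as defined in the context, one has $\tau<\infty$ almost surely).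
   Context: Green function: $G_3(t,x,y)=G_3(t,x-y)=\frac12\mathbf{1}_{\{|x-y|<t\}}$ for $t\ge0$, $x,y\in\mathbb{R}$. Local and global solutions: a local random field solution is a jointly measurable and adapted process $u=\{u(t,x)\}$ satisfying, for all $t\in(0,\tau)$ with $\tau$ some stopping time, $$u(t,x)=\int_{\mathbb{R}} G_3(t,x,y)v_0(y)\,dy+\frac{\partial}{\partial t}\left(\int_{\mathbb{R}} G_3(t,x,y)u_0(y)\,dy\right)+\sigma\int_0^t\int_{\mathbb{R}} G_3(t-s,x,y)\,W(ds\,dy)+\int_0^t\int_{\mathbb{R}} G_3(t-s,x,y)b(u(s,y))\,ds\,dy\quad\text{a.s.},$$ where the stochastic integral is in the sense of Walsh. If one can take $\tau=\infty$, the local solution is a global one. Convention: $1/0=\infty$ in the integrand of the integral condition. *)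

theory Defs
  imports "HOL-Probability.Probability"
begin

text \<open>
  Time runs through \<open>[0,\<infinity>]\<close>, modelled by \<^typ>\<open>ennreal\<close>, so that the library's \<^const>\<open>filtration\<close> and
  \<^const>\<open>stopping_time\<close> apply to stopping times with value \<open>\<infinity>\<close>.  The condition of
  \<^const>\<open>stopping_time\<close> at time \<open>\<infinity>\<close> is void.
\<close>

definition filtered_prob_space :: "'a measure \<Rightarrow> (ennreal \<Rightarrow> 'a measure) \<Rightarrow> bool" where
  "filtered_prob_space M F \<longleftrightarrow>
     prob_space M \<and> filtration (space M) F \<and> (\<forall>t. subalgebra M (F t))"

text \<open>The degenerate law \<open>\<delta>\<^sub>0\<close> counts as a centered Gaussian law.\<close>

definition centered_gaussian :: "'a measure \<Rightarrow> ('a \<Rightarrow> real) \<Rightarrow> bool" where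
  "centered_gaussian M X \<longleftrightarrow> X \<in> borel_measurable M \<and>
     ((AE \<omega> in M. X \<omega> = 0) \<or> (\<exists>s>0. distributed M lborel X (normal_density 0 s)))"

definition noise_sets :: "(real \<times> real) set set" where
  "noise_sets = {A \<in> sets borel. A \<subseteq> {0..} \<times> UNIV \<and> emeasure lborel A < \<infinity>}"

text \<open>
  Space-time white noise relative to \<open>F\<close>: a centered Gaussian process indexed by the Borel sets of
  finite measure in \<open>[0,\<infinity>) \<times> \<real>\<close> with \<open>E[W(A) W(B)] = \<bar>A \<inter> B\<bar>\<close>, adapted to \<open>F\<close>, whose restriction to
  \<open>(t,\<infinity>) \<times> \<real>\<close> is independent of \<open>F t\<close>.
\<close>

definition white_noise ::
  "'a measure \<Rightarrow> (ennreal \<Rightarrow> 'a measure) \<Rightarrow> ((real \<times> real) set \<Rightarrow> 'a \<Rightarrow> real) \<Rightarrow> bool" where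
  "white_noise M F W \<longleftrightarrow>
     (\<forall>I c. finite I \<and> I \<subseteq> noise_sets \<longrightarrow> centered_gaussian M (\<lambda>\<omega>. \<Sum>A\<in>I. c A * W A \<omega>)) \<and>
     (\<forall>A\<in>noise_sets. \<forall>B\<in>noise_sets.
        (LINT \<omega>|M. W A \<omega> * W B \<omega>) = measure lborel (A \<inter> B)) \<and>
     (\<forall>t\<ge>0. \<forall>A\<in>noise_sets. A \<subseteq> {0..t} \<times> UNIV \<longrightarrow> W A \<in> borel_measurable (F (ennreal t))) \<and>
     (\<forall>t\<ge>0. prob_space.indep_set M (sets (F (ennreal t)))
        (sigma_sets (space M)
           {W A -` S \<inter> space M | A S. A \<in> noise_sets \<and> A \<subseteq> {t<..} \<times> UNIV \<and> S \<in> sets borel}))"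

text \<open>
  Walsh integral.  The list entry \<open>(a, b, A, X)\<close> stands for the elementary process
  \<open>X(\<omega>) 1\<^bsub>(a,b]\<^esub>(s) 1\<^bsub>A\<^esub>(y)\<close> with \<open>X\<close> bounded and \<open>F a\<close>-measurable; a list stands for the sum of its
  entries.
\<close>

type_synonym 'a simple_proc = "(real \<times> real \<times> real set \<times> ('a \<Rightarrow> real)) list"

definition simple_proc :: "(ennreal \<Rightarrow> 'a measure) \<Rightarrow> 'a simple_proc \<Rightarrow> bool" where
  "simple_proc F ps \<longleftrightarrow> (\<forall>(a, b, A, X) \<in> set ps.
     0 \<le> a \<and> a \<le> b \<and> A \<in> sets borel \<and> emeasure lborel A < \<infinity> \<and>
     X \<in> borel_measurable (F (ennreal a)) \<and> bounded (X ` space (F (ennreal a))))"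

definition simple_val :: "'a simple_proc \<Rightarrow> real \<Rightarrow> real \<Rightarrow> 'a \<Rightarrow> real" where
  "simple_val ps s y \<omega> = (\<Sum>(a, b, A, X) \<leftarrow> ps. X \<omega> * indicator ({a<..b} \<times> A) (s, y))"

definition simple_integral_upto ::
  "((real \<times> real) set \<Rightarrow> 'a \<Rightarrow> real) \<Rightarrow> real \<Rightarrow> 'a simple_proc \<Rightarrow> 'a \<Rightarrow> real" where
  "simple_integral_upto W t ps \<omega> = (\<Sum>(a, b, A, X) \<leftarrow> ps. X \<omega> * W ({min a t<..min b t} \<times> A) \<omega>)"

definition predictable_sigma :: "(ennreal \<Rightarrow> 'a measure) \<Rightarrow> 'a set \<Rightarrow> (real \<times> real \<times> 'a) measure" where
  "predictable_sigma F \<Omega> = sigma ({0<..} \<times> UNIV \<times> \<Omega>)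
     {{a<..b} \<times> A \<times> E | a b A E. 0 \<le> a \<and> A \<in> sets borel \<and> E \<in> sets (F (ennreal a))}"

text \<open>
  \<open>Z\<close> is a version of \<open>\<integral>\<^sub>0\<^sup>t \<integral>\<^bsub>\<real>\<^esub> f(s,y) W(ds dy)\<close>: the \<open>L\<^sup>2\<close>-limit of the integrals of simple processes
  converging to the predictable integrand \<open>f\<close> in \<open>L\<^sup>2((0,t] \<times> \<real> \<times> \<Omega>)\<close>.  It is determined up to null sets.
\<close>

definition has_walsh_integral ::
  "'a measure \<Rightarrow> (ennreal \<Rightarrow> 'a measure) \<Rightarrow> ((real \<times> real) set \<Rightarrow> 'a \<Rightarrow> real) \<Rightarrow> real \<Rightarrow>
   (real \<Rightarrow> real \<Rightarrow> 'a \<Rightarrow> real) \<Rightarrow> ('a \<Rightarrow> real) \<Rightarrow> bool" where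
  "has_walsh_integral M F W t f Z \<longleftrightarrow>
     (\<lambda>(s, y, \<omega>). f s y \<omega>) \<in> borel_measurable (predictable_sigma F (space M)) \<and>
     Z \<in> borel_measurable M \<and>
     (\<exists>ps. (\<forall>n. simple_proc F (ps n)) \<and>
        (\<lambda>n::nat. \<integral>\<^sup>+\<omega>. (\<integral>\<^sup>+(s, y)\<in>{0<..t} \<times> UNIV.
             ennreal ((f s y \<omega> - simple_val (ps n) s y \<omega>)\<^sup>2) \<partial>lborel) \<partial>M) \<longlonglongrightarrow> 0 \<and>
        (\<lambda>n. \<integral>\<^sup>+\<omega>. ennreal ((Z \<omega> - simple_integral_upto W t (ps n) \<omega>)\<^sup>2) \<partial>M) \<longlonglongrightarrow> 0)"

definition G3 :: "real \<Rightarrow> real \<Rightarrow> real \<Rightarrow> real" where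
  "G3 t x y = (1/2) * (if \<bar>x - y\<bar> < t then 1 else 0)"

text \<open>
  Local random field solution on \<open>(0,\<tau>)\<close>.  The values of \<open>u t x \<omega>\<close> matter only for \<open>0 < t < \<tau> \<omega>\<close>, so
  measurability is required only there.  The equation holds, for every \<open>t > 0\<close> and \<open>x\<close>, almost surely on
  \<open>{t < \<tau>}\<close>.  Integrability of the drift term is stated because the Bochner integral of a
  non-integrable function is \<open>0\<close> by convention.
\<close>

definition local_solution ::
  "'a measure \<Rightarrow> (ennreal \<Rightarrow> 'a measure) \<Rightarrow> ((real \<times> real) set \<Rightarrow> 'a \<Rightarrow> real) \<Rightarrow>
   real \<Rightarrow> (real \<Rightarrow> real) \<Rightarrow> (real \<Rightarrow> real) \<Rightarrow> (real \<Rightarrow> real) \<Rightarrow>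
   ('a \<Rightarrow> ennreal) \<Rightarrow> (real \<Rightarrow> real \<Rightarrow> 'a \<Rightarrow> real) \<Rightarrow> bool" where
  "local_solution M F W \<sigma> b u0 v0 \<tau> u \<longleftrightarrow>
     stopping_time F \<tau> \<and>
     (\<lambda>(t, x, \<omega>). u t x \<omega>) \<in> borel_measurable
        (restrict_space (borel \<Otimes>\<^sub>M borel \<Otimes>\<^sub>M M) {(t, x, \<omega>). 0 < t \<and> ennreal t < \<tau> \<omega>}) \<and>
     (\<forall>t>0. \<forall>x. u t x \<in> borel_measurable
        (restrict_space (F (ennreal t)) {\<omega>. ennreal t < \<tau> \<omega>})) \<and>
     (\<forall>t>0. \<forall>x. \<exists>Z. has_walsh_integral M F W t (\<lambda>s y \<omega>. G3 (t - s) x y) Z \<and>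
        (AE \<omega> in M. ennreal t < \<tau> \<omega> \<longrightarrow>
           set_integrable lborel ({0<..<t} \<times> UNIV) (\<lambda>(s, y). G3 (t - s) x y * b (u s y \<omega>)) \<and>
           u t x \<omega> =
             (LINT y|lborel. G3 t x y * v0 y)
             + deriv (\<lambda>r. LINT y|lborel. G3 r x y * u0 y) t
             + \<sigma> * Z \<omega>
             + (LINT (s, y):{0<..<t} \<times> UNIV|lborel. G3 (t - s) x y * b (u s y \<omega>))))"

end

(* Let L_k = 2^k.  The integral condition says that the sum of h_k = sqrt(8 L_k / b(L_k)) converges.
   On the event that the solution is global, u(t,x) >= sigma/2 W(C) + 1/2 int_C b(u) with C the backward
   light cone of (t,x).  If int_Q b(u) >= 8 L_k, then at any point whose cone contains Q one has
   u >= 3 L_k >= L_(k+1) unless the noise is below -L_k, which has probability O(L_k^-2); hence, up to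
   such a probability, a square of half-side h_(k+1) in the future of Q collects
   int b(u) >= 8 L_(k+1).  The squares can be stacked within a bounded time, so the drift integral
   over one light cone would be infinite.  To start the cascade at a high level with probability close
   to 1, note that on N disjoint cones of height about N the noise is of order N on a fixed
   fraction of them, with concentration as N grows; this gives a drift mass of order N^3. *)

theory Submission
  imports Defs
begin

text \<open>The equation is known only in its mild form, started at time 0, and at each point only
  off a null set of its own; whether the solution is global need not be known at any finite time. So
  there is no restart and no conditioning: every estimate uses the noise on a full cone reaching
  back to time 0, the steps are combined by plain subadditivity, and Fubini leads from single points
  to squares.

  The price is that the noise at time T has standard deviation of order T, however small the squares
  of the cascade are. The first level must therefore beat the time at which the cascade begins. One
  cone with favourable noise is not enough, since the probability has to tend to 1, and N cones side
  by side occupy a strip of width of order N^2, which no point sees as a whole before a time of that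
  order. The noise is then of order N^2 against a mass of order N^3. A first level of order N^(5/2)
  lies between the two and leaves failure probabilities of order 1/N for the start and for the
  cascade alike.\<close>

section \<open>Gaussian noise and independence\<close>

text \<open>Completing the square: weighting by \<open>exp\<close> moves the mean to
  \<open>s\<^sup>2\<close> and leaves a constant factor, so the exponential moment below reduces to
  the total mass of a normal density.\<close>

lemma normal_density_times_exp:
  assumes "s > 0"
  shows "normal_density 0 s x * exp x = exp (s\<^sup>2 / 2) * normal_density (s\<^sup>2) s x"
proof -
  have "- x\<^sup>2 / (2 * s\<^sup>2) + x = s\<^sup>2 / 2 + - (x - s\<^sup>2)\<^sup>2 / (2 * s\<^sup>2)"
    using assms by (simp add: field_simps power2_eq_square)
  then have "exp (- x\<^sup>2 / (2 * s\<^sup>2)) * exp x = exp (s\<^sup>2 / 2) * exp (- (x - s\<^sup>2)\<^sup>2 / (2 * s\<^sup>2))"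
    by (metis exp_add)
  then show ?thesis
    by (simp add: normal_density_def)
qed

context prob_space
begin

lemma centered_gaussian_sq_integrable:
  assumes "centered_gaussian M X"
  shows "integrable M (\<lambda>\<omega>. (X \<omega>)\<^sup>2)"
  using assms unfolding centered_gaussian_def
proof (elim conjE disjE exE)
  assume [measurable]: "X \<in> borel_measurable M" and "AE \<omega> in M. X \<omega> = 0"
  then show ?thesis
    by (subst integrable_cong_AE[of _ _ "\<lambda>_. 0"]) auto
next
  fix s :: real
  assume "s > 0" and D: "distributed M lborel X (normal_density 0 s)"
  show ?thesis
    by (subst distributed_integrable[OF D, symmetric])
      (use \<open>s > 0\<close> integrable_normal_moment[of s 0 2] in auto)
qed

lemma centered_gaussian_mean:
  assumes "centered_gaussian M X"
  shows "expectation X = 0"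
  using assms unfolding centered_gaussian_def
proof (elim conjE disjE exE)
  assume [measurable]: "X \<in> borel_measurable M" and "AE \<omega> in M. X \<omega> = 0"
  then show ?thesis
    by (subst integral_cong_AE[of _ _ "\<lambda>_. 0"]) auto
next
  fix s :: real
  assume "s > 0" and D: "distributed M lborel X (normal_density 0 s)"
  then show ?thesis
    using normal_distributed_expectation by blast
qed

text \<open>Written with the second moment in place of a standard deviation, so that the degenerate
  law is covered too; there the expectation is 1.\<close>

lemma centered_gaussian_exp:
  assumes "centered_gaussian M X"
  shows "integrable M (\<lambda>\<omega>. exp (X \<omega>))"
    and "expectation (\<lambda>\<omega>. exp (X \<omega>)) = exp (expectation (\<lambda>\<omega>. (X \<omega>)\<^sup>2) / 2)"
proof -
  have "integrable M (\<lambda>\<omega>. exp (X \<omega>)) \<and>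
    expectation (\<lambda>\<omega>. exp (X \<omega>)) = exp (expectation (\<lambda>\<omega>. (X \<omega>)\<^sup>2) / 2)"
    using assms unfolding centered_gaussian_def
  proof (elim conjE disjE exE)
    assume [measurable]: "X \<in> borel_measurable M" and ae: "AE \<omega> in M. X \<omega> = 0"
    have "integrable M (\<lambda>\<omega>. exp (X \<omega>))"
      using ae by (subst integrable_cong_AE[of _ _ "\<lambda>_. 1"]) auto
    moreover have "expectation (\<lambda>\<omega>. exp (X \<omega>)) = expectation (\<lambda>_. 1)"
      using ae by (intro integral_cong_AE) auto
    moreover have "expectation (\<lambda>\<omega>. (X \<omega>)\<^sup>2) = expectation (\<lambda>_. 0)"
      using ae by (intro integral_cong_AE) auto
    ultimately show ?thesis
      by (simp add: prob_space)
  next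
    fix s :: real
    assume s: "s > 0" and D: "distributed M lborel X (normal_density 0 s)"
    have eq: "(\<lambda>x. normal_density 0 s x * exp x) = (\<lambda>x. exp (s\<^sup>2 / 2) * normal_density (s\<^sup>2) s x)"
      using normal_density_times_exp[OF s] by auto
    have "integrable M (\<lambda>\<omega>. exp (X \<omega>))"
      by (subst distributed_integrable[OF D, symmetric]) (use s eq in auto)
    moreover have "expectation (\<lambda>\<omega>. exp (X \<omega>)) = exp (s\<^sup>2 / 2)"
      by (subst distributed_integral[OF D, symmetric]) (use s eq in auto)
    moreover have "expectation (\<lambda>\<omega>. (X \<omega>)\<^sup>2) = s\<^sup>2"
      using normal_distributed_variance[OF s D] normal_distributed_expectation[OF s D] by simp
    ultimately show ?thesis
      by simp
  qed
  then show "integrable M (\<lambda>\<omega>. exp (X \<omega>))"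
    "expectation (\<lambda>\<omega>. exp (X \<omega>)) = exp (expectation (\<lambda>\<omega>. (X \<omega>)\<^sup>2) / 2)"
    by auto
qed

end

lemma integrable_mult_of_squares:
  fixes f g :: "'a \<Rightarrow> real"
  assumes [measurable]: "f \<in> borel_measurable M" "g \<in> borel_measurable M"
    and "integrable M (\<lambda>x. (f x)\<^sup>2)" "integrable M (\<lambda>x. (g x)\<^sup>2)"
  shows "integrable M (\<lambda>x. f x * g x)"
proof (rule Bochner_Integration.integrable_bound)
  show "integrable M (\<lambda>x. (f x)\<^sup>2 + (g x)\<^sup>2)"
    using assms by auto
  have "\<bar>f x * g x\<bar> \<le> (f x)\<^sup>2 + (g x)\<^sup>2" for x
  proof -
    have "0 \<le> (f x + g x)\<^sup>2" "0 \<le> (f x - g x)\<^sup>2" "0 \<le> (f x)\<^sup>2" "0 \<le> (g x)\<^sup>2" by auto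
    then show ?thesis
      unfolding power2_sum power2_diff by linarith
  qed
  then show "AE x in M. norm (f x * g x) \<le> norm ((f x)\<^sup>2 + (g x)\<^sup>2)"
    by (intro AE_I2) (metis abs_ge_self order_trans real_norm_def)
qed auto

section \<open>Index sets of the noise, its moments and its additivity\<close>

lemma noise_setsI:
  "A \<in> sets borel \<Longrightarrow> A \<subseteq> {0..} \<times> UNIV \<Longrightarrow> emeasure lborel A < \<infinity> \<Longrightarrow> A \<in> noise_sets"
  by (simp add: noise_sets_def)

lemma noise_sets_subset:
  assumes "A \<in> noise_sets" "B \<in> sets borel" "B \<subseteq> A"
  shows "B \<in> noise_sets"
  using assms emeasure_mono[of B A lborel] by (auto simp: noise_sets_def less_top[symmetric] top_unique)

lemma noise_sets_Un: "A \<in> noise_sets \<Longrightarrow> B \<in> noise_sets \<Longrightarrow> A \<union> B \<in> noise_sets"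
  using emeasure_Un_null_set
  by (auto simp: noise_sets_def intro: le_less_trans[OF emeasure_subadditive])

lemma noise_sets_sets [measurable_dest]: "A \<in> noise_sets \<Longrightarrow> A \<in> sets borel"
  by (simp add: noise_sets_def)

lemma noise_sets_fmeasurable: "A \<in> noise_sets \<Longrightarrow> A \<in> fmeasurable lborel"
  by (simp add: noise_sets_def fmeasurable_def)

locale white_noise_space =
  fixes M :: "'a measure"
    and F :: "ennreal \<Rightarrow> 'a measure"
    and W :: "(real \<times> real) set \<Rightarrow> 'a \<Rightarrow> real"
  assumes filtered: "filtered_prob_space M F"
    and noise: "white_noise M F W"

sublocale white_noise_space \<subseteq> prob_space M
  using filtered by (simp add: filtered_prob_space_def)

context white_noise_space
begin

lemma F_subalgebra: "subalgebra M (F t)"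
  using filtered by (simp add: filtered_prob_space_def)

lemma space_F [simp]: "space (F t) = space M"
  using F_subalgebra[of t] by (simp add: subalgebra_def)

lemma F_mono: "s \<le> t \<Longrightarrow> subalgebra (F t) (F s)"
  using filtered by (auto simp: filtered_prob_space_def filtration_def subalgebra_def)

lemma F_measurable_mono: "X \<in> borel_measurable (F s) \<Longrightarrow> s \<le> t \<Longrightarrow> X \<in> borel_measurable (F t)"
  using F_mono measurable_from_subalg by blast

lemma F_measurable: "X \<in> borel_measurable (F s) \<Longrightarrow> X \<in> borel_measurable M"
  using F_subalgebra measurable_from_subalg by blast

lemma noise_gaussian:
  "finite I \<Longrightarrow> I \<subseteq> noise_sets \<Longrightarrow> centered_gaussian M (\<lambda>\<omega>. \<Sum>A\<in>I. c A * W A \<omega>)"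
  using noise by (simp add: white_noise_def)

lemma noise_gaussian1:
  assumes "A \<in> noise_sets"
  shows "centered_gaussian M (W A)"
  using noise_gaussian[of "{A}" "\<lambda>_. 1"] assms by simp

lemma noise_measurable [measurable]: "A \<in> noise_sets \<Longrightarrow> W A \<in> borel_measurable M"
  using noise_gaussian1 by (auto simp: centered_gaussian_def)

lemma noise_sq_integrable: "A \<in> noise_sets \<Longrightarrow> integrable M (\<lambda>\<omega>. (W A \<omega>)\<^sup>2)"
  using centered_gaussian_sq_integrable noise_gaussian1 by blast

lemma noise_prod_integrable:
  "A \<in> noise_sets \<Longrightarrow> B \<in> noise_sets \<Longrightarrow> integrable M (\<lambda>\<omega>. W A \<omega> * W B \<omega>)"
  by (simp add: integrable_mult_of_squares noise_sq_integrable)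

lemma noise_integrable: "A \<in> noise_sets \<Longrightarrow> integrable M (W A)"
  using square_integrable_imp_integrable noise_sq_integrable noise_measurable by blast

lemma noise_mean: "A \<in> noise_sets \<Longrightarrow> expectation (W A) = 0"
  using centered_gaussian_mean noise_gaussian1 by blast

lemma noise_cov:
  "A \<in> noise_sets \<Longrightarrow> B \<in> noise_sets \<Longrightarrow>
    expectation (\<lambda>\<omega>. W A \<omega> * W B \<omega>) = measure lborel (A \<inter> B)"
  using noise by (simp add: white_noise_def)

lemma noise_sq: "A \<in> noise_sets \<Longrightarrow> expectation (\<lambda>\<omega>. (W A \<omega>)\<^sup>2) = measure lborel A"
  using noise_cov[of A A] by (simp add: power2_eq_square)

text \<open>Additivity comes from the covariance: expanding the second moment of the difference
  gives |A| + |B| + |A| + |B| - 2|A| - 2|B| = 0. The null set depends on the two sets.\<close>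

lemma noise_add:
  assumes "A \<in> noise_sets" "B \<in> noise_sets" "A \<inter> B = {}"
  shows "AE \<omega> in M. W (A \<union> B) \<omega> = W A \<omega> + W B \<omega>"
proof -
  let ?U = "A \<union> B"
  have U: "?U \<in> noise_sets"
    using assms noise_sets_Un by blast
  note [measurable] = noise_measurable[OF assms(1)] noise_measurable[OF assms(2)] noise_measurable[OF U]
  have ind: "?U \<inter> A = A" "?U \<inter> B = B" by auto
  have mU: "measure lborel ?U = measure lborel A + measure lborel B"
    using assms by (intro measure_Union) (auto simp: noise_sets_def)
  have eq: "(W ?U \<omega> - W A \<omega> - W B \<omega>)\<^sup>2 =
    W ?U \<omega> * W ?U \<omega> + W A \<omega> * W A \<omega> + W B \<omega> * W B \<omega>
      - 2 * (W ?U \<omega> * W A \<omega>) - 2 * (W ?U \<omega> * W B \<omega>) + 2 * (W A \<omega> * W B \<omega>)" for \<omega>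
    by (simp add: power2_eq_square algebra_simps)
  note I = noise_prod_integrable[OF U U] noise_prod_integrable[OF assms(1) assms(1)]
    noise_prod_integrable[OF assms(2) assms(2)] noise_prod_integrable[OF U assms(1)]
    noise_prod_integrable[OF U assms(2)] noise_prod_integrable[OF assms(1,2)]
  have "integrable M (\<lambda>\<omega>. (W ?U \<omega> - W A \<omega> - W B \<omega>)\<^sup>2)"
    unfolding eq using I by auto
  moreover have "expectation (\<lambda>\<omega>. (W ?U \<omega> - W A \<omega> - W B \<omega>)\<^sup>2) = 0"
    unfolding eq using I assms U mU by (simp add: noise_cov ind)
  ultimately have "AE \<omega> in M. (W ?U \<omega> - W A \<omega> - W B \<omega>)\<^sup>2 = 0"
    by (subst (asm) integral_nonneg_eq_0_iff_AE) auto
  then show ?thesis by eventually_elim auto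
qed

section \<open>Independence of past and future, and the isometry for elementary terms\<close>

lemma indep_sets_mono_pair:
  assumes "indep_set A B" "A' \<subseteq> A" "B' \<subseteq> B"
  shows "indep_set A' B'"
  using assms unfolding indep_sets2_eq by (meson subset_iff)

text \<open>The sigma-algebra that \<open>white_noise\<close> makes independent of
  \<open>F t\<close>, packaged as a measure so that products of noise values get their measurability
  from the usual closure rules.\<close>

definition future :: "real \<Rightarrow> 'a measure" where
  "future t = sigma (space M)
     {W A -` S \<inter> space M | A S. A \<in> noise_sets \<and> A \<subseteq> {t<..} \<times> UNIV \<and> S \<in> sets borel}"

lemma space_future [simp]: "space (future t) = space M"
  by (simp add: future_def space_measure_of_conv)

lemma sets_future: "sets (future t) = sigma_sets (space M)
     {W A -` S \<inter> space M | A S. A \<in> noise_sets \<and> A \<subseteq> {t<..} \<times> UNIV \<and> S \<in> sets borel}"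
  unfolding future_def by (rule sets_measure_of) auto

lemma noise_future: "A \<in> noise_sets \<Longrightarrow> A \<subseteq> {t<..} \<times> UNIV \<Longrightarrow> W A \<in> borel_measurable (future t)"
  by (rule measurableI) (auto simp: sets_future intro!: sigma_sets.Basic)

lemma noise_adapted:
  "A \<in> noise_sets \<Longrightarrow> A \<subseteq> {0..t} \<times> UNIV \<Longrightarrow> 0 \<le> t \<Longrightarrow> W A \<in> borel_measurable (F (ennreal t))"
  using noise by (simp add: white_noise_def)

lemma indep_past_future:
  assumes "0 \<le> t" "X \<in> borel_measurable (F (ennreal t))" "Y \<in> borel_measurable (future t)"
  shows "indep_var borel X borel Y"
proof -
  have ind: "indep_set (sets (F (ennreal t))) (sets (future t))"
    using noise assms(1) by (simp add: white_noise_def sets_future)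
  have "subalgebra M (future t)"
    using indep_setD_ev2[OF ind] by (simp add: subalgebra_def)
  then have "Y \<in> borel_measurable M"
    using assms(3) measurable_from_subalg by blast
  moreover have XM: "X \<in> borel_measurable M"
    using assms F_measurable by blast
  moreover have "sigma_sets (space M) {X -` A \<inter> space M |A. A \<in> sets borel} \<subseteq> sets (F (ennreal t))"
    using measurable_sets[OF assms(2)] sets.sigma_sets_subset[of _ "F (ennreal t)"] by (simp add: Setcompr_eq_image image_subset_iff)
  moreover have "sigma_sets (space M) {Y -` A \<inter> space M |A. A \<in> sets borel} \<subseteq> sets (future t)"
    using measurable_sets[OF assms(3)] sets.sigma_sets_subset[of _ "future t"] by (simp add: Setcompr_eq_image image_subset_iff)
  ultimately show ?thesis
    unfolding indep_var_eq using indep_sets_mono_pair[OF ind] by simp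
qed

text \<open>The set \<open>B\<close> may be any noise set after time \<open>a\<close>, not just a
  rectangle. This lets a deterministic indicator, such as that of a light cone, count as one more
  elementary term.\<close>

definition elementary :: "real \<Rightarrow> (real \<times> real) set \<Rightarrow> ('a \<Rightarrow> real) \<Rightarrow> bool" where
  "elementary a B X \<longleftrightarrow> 0 \<le> a \<and> B \<in> noise_sets \<and> B \<subseteq> {a<..} \<times> UNIV \<and>
     X \<in> borel_measurable (F (ennreal a)) \<and> bounded (X ` space M)"

lemma elementary_D:
  assumes "elementary a B X"
  shows "0 \<le> a" "B \<in> noise_sets" "B \<subseteq> {a<..} \<times> UNIV" "X \<in> borel_measurable (F (ennreal a))"
    "bounded (X ` space M)" "X \<in> borel_measurable M"
  using assms F_measurable by (auto simp: elementary_def)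

lemma integrable_bounded_mult:
  assumes "X \<in> borel_measurable M" "bounded (X ` space M)" "integrable M Y"
  shows "integrable M (\<lambda>\<omega>. X \<omega> * (Y \<omega> :: real))"
proof -
  obtain K where "\<And>\<omega>. \<omega> \<in> space M \<Longrightarrow> \<bar>X \<omega>\<bar> \<le> K"
    using assms(2) by (auto simp: bounded_iff)
  then have "\<bar>X \<omega> * Y \<omega>\<bar> \<le> \<bar>K * Y \<omega>\<bar>" if "\<omega> \<in> space M" for \<omega>
    using mult_right_mono[OF order_trans[OF _ abs_ge_self[of K]], of "\<bar>X \<omega>\<bar>" "\<bar>Y \<omega>\<bar>"] that
    by (simp add: abs_mult)
  then have "AE \<omega> in M. norm (X \<omega> * Y \<omega>) \<le> norm (K * Y \<omega>)"
    by (intro AE_I2) simp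
  moreover have "(\<lambda>\<omega>. X \<omega> * Y \<omega>) \<in> borel_measurable M"
    using assms(1) borel_measurable_integrable[OF assms(3)] by (rule borel_measurable_times)
  ultimately show ?thesis
    using assms(3) by (intro Bochner_Integration.integrable_bound[of M "\<lambda>\<omega>. K * Y \<omega>" "\<lambda>\<omega>. X \<omega> * Y \<omega>"] integrable_mult_right)
qed

lemma elementary_prod_integrable:
  assumes "elementary a B X" "elementary a' B' X'"
  shows "integrable M (\<lambda>\<omega>. (X \<omega> * W B \<omega>) * (X' \<omega> * W B' \<omega>))" "integrable M (\<lambda>\<omega>. X \<omega> * X' \<omega>)"
proof -
  note D = elementary_D[OF assms(1)] and D' = elementary_D[OF assms(2)]
  have "integrable M (\<lambda>\<omega>. X \<omega> * (X' \<omega> * (W B \<omega> * W B' \<omega>)))"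
    by (intro integrable_bounded_mult D D' noise_prod_integrable)
  then show "integrable M (\<lambda>\<omega>. (X \<omega> * W B \<omega>) * (X' \<omega> * W B' \<omega>))"
    by (simp add: ac_simps)
  have "integrable M (\<lambda>\<omega>. X \<omega> * (X' \<omega> * 1))"
    by (intro integrable_bounded_mult D D') auto
  then show "integrable M (\<lambda>\<omega>. X \<omega> * X' \<omega>)" by simp
qed

text \<open>
  The earlier set is cut at the starting time of the later one: the part before it is independent of
  the increment of the later one and contributes nothing.
\<close>

lemma elementary_isometry_ordered:
  assumes "elementary a B X" "elementary a' B' X'" "a \<le> a'"
  shows "expectation (\<lambda>\<omega>. (X \<omega> * W B \<omega>) * (X' \<omega> * W B' \<omega>)) =
    expectation (\<lambda>\<omega>. X \<omega> * X' \<omega>) * measure lborel (B \<inter> B')"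
proof -
  note D = elementary_D[OF assms(1)] and D' = elementary_D[OF assms(2)]
  define B1 where "B1 = B \<inter> {..a'} \<times> UNIV"
  define B2 where "B2 = B \<inter> {a'<..} \<times> UNIV"
  have [measurable]: "B \<in> sets borel" by (rule noise_sets_sets[OF D(2)])
  have "{..a'} \<times> (UNIV :: real set) \<in> sets (borel \<Otimes>\<^sub>M borel)" "{a'<..} \<times> (UNIV :: real set) \<in> sets (borel \<Otimes>\<^sub>M borel)"
    by auto
  then have BS: "B1 \<in> sets borel" "B2 \<in> sets borel"
    unfolding B1_def B2_def borel_prod by auto
  have "B1 \<subseteq> B" "B2 \<subseteq> B" unfolding B1_def B2_def by auto
  then have N: "B1 \<in> noise_sets" "B2 \<in> noise_sets"
    using BS D(2) by (simp_all add: noise_sets_subset)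
  have B: "B = B1 \<union> B2" "B1 \<inter> B2 = {}" unfolding B1_def B2_def by auto
  have X: "X \<in> borel_measurable (F (ennreal a'))"
    by (rule F_measurable_mono[OF D(4)]) (simp add: assms(3) ennreal_leI)
  have W1: "W B1 \<in> borel_measurable (F (ennreal a'))"
    using D(1,3) by (intro noise_adapted N D'(1)) (auto simp: B1_def)
  have W': "W B' \<in> borel_measurable (future a')"
    by (intro noise_future D')
  have W2: "W B2 \<in> borel_measurable (future a')"
    by (rule noise_future[OF N(2)]) (auto simp: B2_def)
  note [measurable] = D(6) D'(6) noise_measurable[OF D(2)] noise_measurable[OF D'(2)]
    noise_measurable[OF N(1)] noise_measurable[OF N(2)]
  \<comment> \<open>The trailing \<open>1\<close> lets \<open>integrable_bounded_mult\<close> strip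
    \<open>X\<close> and \<open>X'\<close> one after the other and end at an integrable
    factor.\<close>
  have int: "integrable M (\<lambda>\<omega>. X \<omega> * (X' \<omega> * W B1 \<omega>))" "integrable M (\<lambda>\<omega>. X \<omega> * (X' \<omega> * 1))"
    by (intro integrable_bounded_mult D D' noise_integrable N; simp)+
  have v: "indep_var borel (\<lambda>\<omega>. X \<omega> * (X' \<omega> * W B1 \<omega>)) borel (W B')"
    by (intro indep_past_future[OF D'(1)] borel_measurable_times X D'(4) W1 W')
  have 1: "expectation (\<lambda>\<omega>. (X \<omega> * (X' \<omega> * W B1 \<omega>)) * W B' \<omega>) = 0"
    using indep_var_lebesgue_integral[OF v int(1) noise_integrable[OF D'(2)]] noise_mean[OF D'(2)]
    by simp
  have v2: "indep_var borel (\<lambda>\<omega>. X \<omega> * (X' \<omega> * 1)) borel (\<lambda>\<omega>. W B2 \<omega> * W B' \<omega>)"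
    by (intro indep_past_future[OF D'(1)] borel_measurable_times borel_measurable_const X D'(4) W2 W')
  have "B2 \<inter> B' = B \<inter> B'"
    using D'(3) by (auto simp: B2_def)
  then have 2: "expectation (\<lambda>\<omega>. (X \<omega> * (X' \<omega> * 1)) * (W B2 \<omega> * W B' \<omega>)) =
      expectation (\<lambda>\<omega>. X \<omega> * X' \<omega>) * measure lborel (B \<inter> B')"
    using indep_var_lebesgue_integral[OF v2 int(2) noise_prod_integrable[OF N(2) D'(2)]]
      noise_cov[OF N(2) D'(2)] by simp
  have I1: "integrable M (\<lambda>\<omega>. (X \<omega> * (X' \<omega> * W B1 \<omega>)) * W B' \<omega>)"
    using indep_var_integrable[OF v int(1) noise_integrable[OF D'(2)]] .
  have I2: "integrable M (\<lambda>\<omega>. (X \<omega> * (X' \<omega> * 1)) * (W B2 \<omega> * W B' \<omega>))"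
    using indep_var_integrable[OF v2 int(2) noise_prod_integrable[OF N(2) D'(2)]] .
  have "expectation (\<lambda>\<omega>. (X \<omega> * W B \<omega>) * (X' \<omega> * W B' \<omega>)) =
    expectation (\<lambda>\<omega>. (X \<omega> * (X' \<omega> * W B1 \<omega>)) * W B' \<omega> + (X \<omega> * (X' \<omega> * 1)) * (W B2 \<omega> * W B' \<omega>))"
    using noise_add[OF N B(2), folded B(1)]
    by (intro integral_cong_AE) (auto elim!: eventually_mono simp: algebra_simps)
  also have "\<dots> = expectation (\<lambda>\<omega>. X \<omega> * X' \<omega>) * measure lborel (B \<inter> B')"
    by (subst Bochner_Integration.integral_add[OF I1 I2]) (simp only: 1 2 add_0)
  finally show ?thesis .
qed

lemma elementary_isometry:
  assumes "elementary a B X" "elementary a' B' X'"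
  shows "expectation (\<lambda>\<omega>. (X \<omega> * W B \<omega>) * (X' \<omega> * W B' \<omega>)) =
    expectation (\<lambda>\<omega>. X \<omega> * X' \<omega>) * measure lborel (B \<inter> B')"
proof (cases "a \<le> a'")
  case False
  then show ?thesis
    using elementary_isometry_ordered[OF assms(2,1)] by (simp add: ac_simps Int_commute)
qed (use elementary_isometry_ordered[OF assms] in simp)

end

section \<open>The Walsh integral of an indicator\<close>

context white_noise_space
begin

text \<open>Both sides expand to the same double sum over pairs, by
  \<open>elementary_isometry\<close> on the left and by integrating products of indicators on the
  right. Extended integrals are used because \<open>has_walsh_integral\<close> measures its errors
  with them.\<close>

lemma elementary_sum_isometry:
  assumes fin: "finite I" and el: "\<And>i. i \<in> I \<Longrightarrow> elementary (a i) (B i) (X i)"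
  shows "(\<integral>\<^sup>+\<omega>. ennreal ((\<Sum>i\<in>I. X i \<omega> * W (B i) \<omega>)\<^sup>2) \<partial>M) =
    (\<integral>\<^sup>+\<omega>. (\<integral>\<^sup>+q. ennreal ((\<Sum>i\<in>I. X i \<omega> * indicator (B i) q)\<^sup>2) \<partial>lborel) \<partial>M)"
proof -
  let ?K = "\<Sum>i\<in>I. \<Sum>j\<in>I. expectation (\<lambda>\<omega>. X i \<omega> * X j \<omega>) * measure lborel (B i \<inter> B j)"
  note PI = elementary_prod_integrable[OF el el]
  have "(\<integral>\<^sup>+\<omega>. ennreal ((\<Sum>i\<in>I. X i \<omega> * W (B i) \<omega>)\<^sup>2) \<partial>M) =
    ennreal (expectation (\<lambda>\<omega>. (\<Sum>i\<in>I. X i \<omega> * W (B i) \<omega>)\<^sup>2))"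
    by (rule nn_integral_eq_integral) (simp add: power2_eq_square sum_product PI, simp)
  also have "expectation (\<lambda>\<omega>. (\<Sum>i\<in>I. X i \<omega> * W (B i) \<omega>)\<^sup>2) = ?K"
    by (simp add: power2_eq_square sum_product PI elementary_isometry[OF el el])
  finally have 1: "(\<integral>\<^sup>+\<omega>. ennreal ((\<Sum>i\<in>I. X i \<omega> * W (B i) \<omega>)\<^sup>2) \<partial>M) = ennreal ?K" .
  let ?Q = "\<lambda>\<omega>. \<Sum>i\<in>I. \<Sum>j\<in>I. X i \<omega> * X j \<omega> * measure lborel (B i \<inter> B j)"
  have fm: "B i \<inter> B j \<in> fmeasurable lborel" if "i \<in> I" "j \<in> I" for i j
    using elementary_D(2)[OF el] noise_sets_fmeasurable that by blast
  have sq: "(\<Sum>i\<in>I. X i \<omega> * indicator (B i) q)\<^sup>2 =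
    (\<Sum>i\<in>I. \<Sum>j\<in>I. X i \<omega> * X j \<omega> * indicator (B i \<inter> B j) q)" for \<omega> q
    by (simp add: power2_eq_square sum_product indicator_inter_arith ac_simps)
  have in1: "integrable lborel (\<lambda>q. X i \<omega> * X j \<omega> * indicator (B i \<inter> B j) q)"
    if "i \<in> I" "j \<in> I" for i j \<omega>
    using fm[OF that] by (intro integrable_mult_right) (auto simp: fmeasurable_def)
  have in2: "integrable lborel (\<lambda>q. (\<Sum>i\<in>I. X i \<omega> * indicator (B i) q)\<^sup>2)" for \<omega>
    unfolding sq by (intro Bochner_Integration.integrable_sum in1)
  have Q: "integral\<^sup>L lborel (\<lambda>q. (\<Sum>i\<in>I. X i \<omega> * indicator (B i) q)\<^sup>2) = ?Q \<omega>" for \<omega>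
    unfolding sq using in1 fm by (simp add: Bochner_Integration.integral_sum fmeasurable_def)
  have inner: "(\<integral>\<^sup>+q. ennreal ((\<Sum>i\<in>I. X i \<omega> * indicator (B i) q)\<^sup>2) \<partial>lborel) = ennreal (?Q \<omega>)" for \<omega>
    unfolding Q[symmetric] by (rule nn_integral_eq_integral[OF in2]) simp
  have "(\<integral>\<^sup>+\<omega>. ennreal (?Q \<omega>) \<partial>M) = ennreal (expectation ?Q)"
    by (rule nn_integral_eq_integral) (simp add: PI, simp add: Q[symmetric])
  also have "expectation ?Q = ?K"
    by (simp add: PI)
  finally show ?thesis
    unfolding 1 inner ..
qed

lemma noise_sets_rectangle:
  assumes "0 \<le> a" "A \<in> sets borel" "emeasure lborel A < \<infinity>"
  shows "{a<..b} \<times> A \<in> noise_sets"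
proof (rule noise_setsI)
  have "{a<..b} \<times> A \<in> sets (borel \<Otimes>\<^sub>M borel)"
    using assms by auto
  then show "{a<..b} \<times> A \<in> sets borel"
    unfolding borel_prod .
  have "emeasure lborel ({a<..b} \<times> A) = emeasure lborel {a<..b} * emeasure lborel A"
    using assms by (subst lborel_prod[symmetric], subst lborel.emeasure_pair_measure_Times) auto
  also have "\<dots> < \<infinity>"
  proof -
    have "emeasure lborel {a<..b} < \<infinity>"
      by (cases "a \<le> b") auto
    then show ?thesis
      using assms by (simp add: ennreal_mult_less_top)
  qed
  finally show "emeasure lborel ({a<..b} \<times> A) < \<infinity>" .
qed (use assms in auto)

text \<open>The integrand is itself elementary, so its difference from a simple process is a finite
  sum of elementary terms. The isometry then identifies the error of the integrals with the error of
  the integrands, which tends to 0 by assumption; \<open>C\<close> is never approximated by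
  rectangles.\<close>

lemma walsh_integral_of_indicator:
  assumes walsh: "has_walsh_integral M F W t f Z"
    and C: "C \<in> noise_sets" "C \<subseteq> {0<..t} \<times> UNIV"
    and f: "\<And>s y \<omega>. 0 < s \<Longrightarrow> s \<le> t \<Longrightarrow> f s y \<omega> = c * indicator C (s, y)"
  shows "AE \<omega> in M. Z \<omega> = c * W C \<omega>"
proof -
  obtain ps where Z [measurable]: "Z \<in> borel_measurable M"
    and ps: "\<And>n. simple_proc F (ps n)"
    and lim1: "(\<lambda>n::nat. \<integral>\<^sup>+\<omega>. (\<integral>\<^sup>+(s, y)\<in>{0<..t} \<times> UNIV.
             ennreal ((f s y \<omega> - simple_val (ps n) s y \<omega>)\<^sup>2) \<partial>lborel) \<partial>M) \<longlonglongrightarrow> 0"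
    and lim2: "(\<lambda>n. \<integral>\<^sup>+\<omega>. ennreal ((Z \<omega> - simple_integral_upto W t (ps n) \<omega>)\<^sup>2) \<partial>M) \<longlonglongrightarrow> 0"
    using walsh unfolding has_walsh_integral_def by blast
  note [measurable] = noise_measurable[OF C(1)]
  have meas [measurable]: "simple_integral_upto W t (ps n) \<in> borel_measurable M"
    and eq: "(\<integral>\<^sup>+\<omega>. ennreal ((simple_integral_upto W t (ps n) \<omega> - c * W C \<omega>)\<^sup>2) \<partial>M) =
      (\<integral>\<^sup>+\<omega>. (\<integral>\<^sup>+(s, y)\<in>{0<..t} \<times> UNIV.
             ennreal ((f s y \<omega> - simple_val (ps n) s y \<omega>)\<^sup>2) \<partial>lborel) \<partial>M)" for n
  proof -
    define m where "m = length (ps n)"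
    define a where "a i = fst (ps n ! i)" for i
    define b where "b i = fst (snd (ps n ! i))" for i
    define A where "A i = fst (snd (snd (ps n ! i)))" for i
    define X where "X i = snd (snd (snd (ps n ! i)))" for i
    define R where "R i = {min (a i) t<..min (b i) t} \<times> A i" for i
    have nth: "ps n ! i = (a i, b i, A i, X i)" for i
      by (simp add: a_def b_def A_def X_def)
    have el0: "0 \<le> a i" "A i \<in> sets borel" "emeasure lborel (A i) < \<infinity>"
      "X i \<in> borel_measurable (F (ennreal (a i)))" "bounded (X i ` space M)" if "i < m" for i
    proof -
      have "ps n ! i \<in> set (ps n)"
        using that by (simp add: m_def)
      with ps[of n] show "0 \<le> a i" "A i \<in> sets borel" "emeasure lborel (A i) < \<infinity>"
        "X i \<in> borel_measurable (F (ennreal (a i)))" "bounded (X i ` space M)"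
        unfolding simple_proc_def nth by fastforce+
    qed
    \<comment> \<open>If \<open>a i\<close> exceeds \<open>t\<close>, clipping moves the left end
      below \<open>a i\<close>, but the rectangle is then empty.\<close>
    have el: "elementary (a i) (R i) (X i)" if "i < m" for i
    proof (cases "a i \<le> t")
      case True
      then show ?thesis
        unfolding elementary_def R_def using el0[OF that] noise_sets_rectangle by auto
    next
      case False
      then have "R i = {}" by (auto simp: R_def)
      moreover have "{} \<in> noise_sets" by (auto simp: noise_sets_def)
      ultimately show ?thesis
        unfolding elementary_def using el0[OF that] by auto
    qed
    have elC: "elementary 0 C (\<lambda>_. - c)"
      unfolding elementary_def using C by (auto simp: image_constant_conv)
    \<comment> \<open>The term belonging to \<open>- c * W C\<close> is appended at index
      \<open>m\<close>, so that the whole error is one elementary sum.\<close>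
    let ?a = "a(m := 0)" and ?B = "R(m := C)" and ?X = "X(m := (\<lambda>_. - c))"
    have el': "elementary (?a i) (?B i) (?X i)" if "i \<in> {..m}" for i
      using that el elC by auto
    have sp: "simple_integral_upto W t (ps n) \<omega> = (\<Sum>i<m. X i \<omega> * W (R i) \<omega>)" for \<omega>
      by (simp add: simple_integral_upto_def sum_list_sum_nth nth R_def m_def atLeast0LessThan)
    show "simple_integral_upto W t (ps n) \<in> borel_measurable M"
      unfolding sp using elementary_D(2,6)[OF el]
      by (intro borel_measurable_sum borel_measurable_times noise_measurable) auto
    have sI: "simple_integral_upto W t (ps n) \<omega> - c * W C \<omega> = (\<Sum>i\<in>{..m}. ?X i \<omega> * W (?B i) \<omega>)" for \<omega>
    proof -
      have "(\<Sum>i\<in>{..m}. ?X i \<omega> * W (?B i) \<omega>) = (\<Sum>i<m. ?X i \<omega> * W (?B i) \<omega>) - c * W C \<omega>"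
        by (simp add: lessThan_Suc_atMost[symmetric])
      also have "(\<Sum>i<m. ?X i \<omega> * W (?B i) \<omega>) = (\<Sum>i<m. X i \<omega> * W (R i) \<omega>)"
        by (intro sum.cong) auto
      finally show ?thesis by (simp add: sp)
    qed
    have sV: "(\<Sum>i\<in>{..m}. ?X i \<omega> * indicator (?B i) (s, y)) =
      (if s \<in> {0<..t} then simple_val (ps n) s y \<omega> - f s y \<omega> else 0)" for s y \<omega>
    proof -
      have "(\<Sum>i\<in>{..m}. ?X i \<omega> * indicator (?B i) (s, y)) =
          (\<Sum>i<m. ?X i \<omega> * indicator (?B i) (s, y)) - c * indicator C (s, y)"
        by (simp add: lessThan_Suc_atMost[symmetric])
      also have "(\<Sum>i<m. ?X i \<omega> * indicator (?B i) (s, y)) = (\<Sum>i<m. X i \<omega> * indicator (R i) (s, y))"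
        by (intro sum.cong) auto
      finally have s: "(\<Sum>i\<in>{..m}. ?X i \<omega> * indicator (?B i) (s, y)) =
        (\<Sum>i<m. X i \<omega> * indicator (R i) (s, y)) - c * indicator C (s, y)" .
      show ?thesis
      proof (cases "s \<in> {0<..t}")
        case True
        have "simple_val (ps n) s y \<omega> = (\<Sum>i<m. X i \<omega> * indicator ({a i<..b i} \<times> A i) (s, y))"
          by (simp add: simple_val_def sum_list_sum_nth nth m_def atLeast0LessThan)
        also have "\<dots> = (\<Sum>i<m. X i \<omega> * indicator (R i) (s, y))"
          using True by (intro sum.cong) (auto simp: R_def indicator_def)
        finally show ?thesis
          using s True f by simp
      next
        case False
        have "indicator (R i) (s, y) = (0::real)" if "i < m" for i
          using False el0(1)[OF that] by (auto simp: R_def indicator_def)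
        moreover have "indicator C (s, y) = (0::real)"
          using False C(2) by (auto simp: indicator_def)
        ultimately show ?thesis
          unfolding s using False by auto
      qed
    qed
    have sV': "ennreal ((\<Sum>i\<in>{..m}. ?X i \<omega> * indicator (?B i) q)\<^sup>2) =
      (case q of (s, y) \<Rightarrow> ennreal ((f s y \<omega> - simple_val (ps n) s y \<omega>)\<^sup>2)) * indicator ({0<..t} \<times> UNIV) q" for q \<omega>
      by (cases q) (simp only: sV prod.case, simp add: power2_commute indicator_def)
    show "(\<integral>\<^sup>+\<omega>. ennreal ((simple_integral_upto W t (ps n) \<omega> - c * W C \<omega>)\<^sup>2) \<partial>M) =
      (\<integral>\<^sup>+\<omega>. (\<integral>\<^sup>+(s, y)\<in>{0<..t} \<times> UNIV.
             ennreal ((f s y \<omega> - simple_val (ps n) s y \<omega>)\<^sup>2) \<partial>lborel) \<partial>M)"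
      unfolding sI by (subst elementary_sum_isometry[OF finite_atMost el']) (simp_all only: sV')
  qed
  let ?I = "\<lambda>n. simple_integral_upto W t (ps n)"
  let ?E = "\<integral>\<^sup>+\<omega>. ennreal ((Z \<omega> - c * W C \<omega>)\<^sup>2) \<partial>M"
  have "?E \<le> 2 * (\<integral>\<^sup>+\<omega>. ennreal ((Z \<omega> - ?I n \<omega>)\<^sup>2) \<partial>M) + 2 * (\<integral>\<^sup>+\<omega>. ennreal ((?I n \<omega> - c * W C \<omega>)\<^sup>2) \<partial>M)" for n
  proof -
    have "(x + y)\<^sup>2 \<le> 2 * x\<^sup>2 + 2 * y\<^sup>2" for x y :: real
      using zero_le_power2[of "x - y"] unfolding power2_sum power2_diff by linarith
    from this[of "Z \<omega> - ?I n \<omega>" "?I n \<omega> - c * W C \<omega>" for \<omega>]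
    have "(Z \<omega> - c * W C \<omega>)\<^sup>2 \<le> 2 * (Z \<omega> - ?I n \<omega>)\<^sup>2 + 2 * (?I n \<omega> - c * W C \<omega>)\<^sup>2" for \<omega>
      by simp
    moreover have "2 * ennreal (x\<^sup>2) + 2 * ennreal (y\<^sup>2) = ennreal (2 * x\<^sup>2 + 2 * y\<^sup>2)" for x y :: real
      by (simp add: ennreal_mult' ennreal_plus)
    ultimately have "ennreal ((Z \<omega> - c * W C \<omega>)\<^sup>2) \<le>
        2 * ennreal ((Z \<omega> - ?I n \<omega>)\<^sup>2) + 2 * ennreal ((?I n \<omega> - c * W C \<omega>)\<^sup>2)" for \<omega>
      by (simp only: ennreal_leI)
    then have "?E \<le> (\<integral>\<^sup>+\<omega>. 2 * ennreal ((Z \<omega> - ?I n \<omega>)\<^sup>2) + 2 * ennreal ((?I n \<omega> - c * W C \<omega>)\<^sup>2) \<partial>M)"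
      by (intro nn_integral_mono)
    also have "\<dots> = 2 * (\<integral>\<^sup>+\<omega>. ennreal ((Z \<omega> - ?I n \<omega>)\<^sup>2) \<partial>M) + 2 * (\<integral>\<^sup>+\<omega>. ennreal ((?I n \<omega> - c * W C \<omega>)\<^sup>2) \<partial>M)"
      by (simp add: nn_integral_add nn_integral_cmult)
    finally show ?thesis .
  qed
  moreover have "(\<lambda>n. 2 * (\<integral>\<^sup>+\<omega>. ennreal ((Z \<omega> - ?I n \<omega>)\<^sup>2) \<partial>M) +
      2 * (\<integral>\<^sup>+\<omega>. ennreal ((?I n \<omega> - c * W C \<omega>)\<^sup>2) \<partial>M)) \<longlonglongrightarrow> 2 * 0 + 2 * 0"
    unfolding eq by (intro tendsto_add ennreal_tendsto_cmult lim1 lim2) auto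
  ultimately have "?E \<le> 2 * 0 + 2 * 0"
    by (intro LIMSEQ_le_const[where X="\<lambda>n. 2 * (\<integral>\<^sup>+\<omega>. ennreal ((Z \<omega> - ?I n \<omega>)\<^sup>2) \<partial>M) +
      2 * (\<integral>\<^sup>+\<omega>. ennreal ((?I n \<omega> - c * W C \<omega>)\<^sup>2) \<partial>M)"]) auto
  then have "?E = 0" by simp
  then show ?thesis
    by (subst (asm) nn_integral_0_iff_AE) (auto simp: ennreal_eq_0_iff power2_le_iff_abs_le)
qed

end

section \<open>The integral condition on dyadic scales\<close>

lemma disjoint_dyadic_intervals: "disjoint_family (\<lambda>k. {2 ^ (m + k)..<(2::real) ^ (m + Suc k)})"
proof -
  have "{2 ^ (m + i)..<(2::real) ^ (m + Suc i)} \<inter> {2 ^ (m + j)..<2 ^ (m + Suc j)} = {}" if "i < j" for i j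
  proof -
    have "(2::real) ^ (m + Suc i) \<le> 2 ^ (m + j)"
      using that by (intro power_increasing) auto
    then show ?thesis by auto
  qed
  then show ?thesis
    unfolding disjoint_family_on_def by (metis Int_commute linorder_neqE_nat)
qed

lemma set_integral_le_endpoint:
  fixes b :: "real \<Rightarrow> real"
  assumes nonneg: "\<And>z. 0 \<le> b z" and mono: "mono b" and "0 < \<alpha>" "\<alpha> \<le> s"
  shows "(LINT r:{\<alpha>..s}|lborel. b r) \<le> s * b s"
proof -
  have "(LINT r:{\<alpha>..s}|lborel. b r) \<le> (LINT r:{\<alpha>..s}|lborel. b s)"
    unfolding set_lebesgue_integral_def
  proof (rule integral_mono')
    show "integrable lborel (\<lambda>x. indicator {\<alpha>..s} x *\<^sub>R b s)"
      by (intro integrable_scaleR_left integrable_real_indicator) (use assms in auto)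
  qed (use nonneg monoD[OF mono] in \<open>auto simp: indicator_def\<close>)
  also have "\<dots> = (s - \<alpha>) * b s"
    using assms(3,4) by (simp add: set_lebesgue_integral_def)
  also have "\<dots> \<le> s * b s"
    using assms by (intro mult_right_mono) auto
  finally show ?thesis .
qed

context
  fixes b :: "real \<Rightarrow> real" and \<alpha> \<beta> :: real
  assumes nonneg: "\<And>z. 0 \<le> b z" and mono: "mono b" and pos: "\<alpha> > 0" "\<beta> > 0"
    and int: "(\<integral>\<^sup>+s\<in>{\<alpha>..}. 1 / ennreal (sqrt (\<beta>\<^sup>2 + 2 * (LINT r:{\<alpha>..s}|lborel. b r))) \<partial>lborel) < \<infinity>"
begin

text \<open>On a dyadic interval the integrand is at least its value with the inner integral
  replaced by the bound at the right endpoint. The numerator \<open>2 ^ (m + k)\<close> is the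
  length of that interval.\<close>

lemma osgood_dyadic_sum:
  assumes "\<alpha> \<le> 2 ^ m"
  shows "summable (\<lambda>k. 2 ^ (m + k) / sqrt (\<beta>\<^sup>2 + 2 * (2 ^ (m + Suc k) * b (2 ^ (m + Suc k)))))"
proof -
  let ?J = "\<lambda>s. LINT r:{\<alpha>..s}|lborel. b r"
  let ?A = "\<lambda>k. {2 ^ (m + k)..<(2::real) ^ (m + Suc k)}"
  define D where "D k = sqrt (\<beta>\<^sup>2 + 2 * (2 ^ (m + Suc k) * b (2 ^ (m + Suc k))))" for k
  have D: "0 < D k" for k
    unfolding D_def using pos nonneg by (intro real_sqrt_gt_zero add_pos_nonneg) auto
  have le: "(\<Sum>k. ennreal (1 / D k) * indicator (?A k) s) \<le>
    1 / ennreal (sqrt (\<beta>\<^sup>2 + 2 * ?J s)) * indicator {\<alpha>..} s" for s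
  proof (cases "\<exists>k. s \<in> ?A k")
    case False
    then have "indicator (?A k) s = (0::ennreal)" for k by simp
    then show ?thesis by simp
  next
    case True
    then obtain k where k: "s \<in> ?A k" by blast
    have "(2::real) ^ m \<le> 2 ^ (m + k)" by simp
    also have "\<dots> \<le> s" using k by simp
    finally have s: "\<alpha> \<le> s" "s \<le> 2 ^ (m + Suc k)" using k assms by auto
    have "?J s \<le> s * b s"
      by (rule set_integral_le_endpoint[OF nonneg mono pos(1) s(1)])
    also have "\<dots> \<le> 2 ^ (m + Suc k) * b (2 ^ (m + Suc k))"
      using s pos nonneg by (intro mult_mono monoD[OF mono]) auto
    finally have "sqrt (\<beta>\<^sup>2 + 2 * ?J s) \<le> D k"
      unfolding D_def by simp
    moreover have "0 \<le> ?J s"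
      unfolding set_lebesgue_integral_def using nonneg by simp
    then have "0 < sqrt (\<beta>\<^sup>2 + 2 * ?J s)"
      using pos by (intro real_sqrt_gt_zero add_pos_nonneg) auto
    ultimately have "ennreal (1 / D k) \<le> 1 / ennreal (sqrt (\<beta>\<^sup>2 + 2 * ?J s))"
      using D[of k] divide_ennreal[of 1 "sqrt (\<beta>\<^sup>2 + 2 * ?J s)"]
      by (simp add: frac_le ennreal_leI)
    then show ?thesis
      using suminf_cmult_indicator[OF disjoint_dyadic_intervals k, of "\<lambda>k. ennreal (1 / D k)"] s by simp
  qed
  have "(\<Sum>k. ennreal (2 ^ (m + k) / D k)) = (\<Sum>k. \<integral>\<^sup>+s. ennreal (1 / D k) * indicator (?A k) s \<partial>lborel)"
  proof (intro suminf_cong)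
    fix k
    have "(\<integral>\<^sup>+s. ennreal (1 / D k) * indicator (?A k) s \<partial>lborel) = ennreal (1 / D k) * ennreal (2 ^ (m + k))"
      by (subst nn_integral_cmult_indicator) auto
    also have "\<dots> = ennreal (2 ^ (m + k) / D k)"
      using D[of k] by (subst ennreal_mult[symmetric]) auto
    finally show "ennreal (2 ^ (m + k) / D k) = (\<integral>\<^sup>+s. ennreal (1 / D k) * indicator (?A k) s \<partial>lborel)" ..
  qed
  also have "\<dots> = (\<integral>\<^sup>+s. (\<Sum>k. ennreal (1 / D k) * indicator (?A k) s) \<partial>lborel)"
    by (rule nn_integral_suminf[symmetric]) auto
  also have "\<dots> \<le> (\<integral>\<^sup>+s\<in>{\<alpha>..}. 1 / ennreal (sqrt (\<beta>\<^sup>2 + 2 * ?J s)) \<partial>lborel)"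
    by (intro nn_integral_mono le)
  also have "\<dots> < \<infinity>" by (rule int)
  finally have "summable (\<lambda>k. 2 ^ (m + k) / D k)"
    using D by (intro summable_suminf_not_top) (auto simp: less_imp_le)
  then show ?thesis unfolding D_def .
qed

text \<open>Otherwise the terms of \<open>osgood_dyadic_sum\<close> would be
  \<open>2 ^ (m + k) / \<beta>\<close>, which do not tend to 0. The level found here is the one from
  which the noise starts the drift.\<close>

lemma osgood_positive: "\<exists>k. 0 < b (2 ^ k)"
proof (rule ccontr)
  assume "\<not> ?thesis"
  then have b0: "b (2 ^ k) = 0" for k
    using nonneg[of "2 ^ k"] by (meson antisym not_less)
  obtain m where m: "\<alpha> \<le> 2 ^ m"
    using real_arch_pow[of 2 \<alpha>] by (auto intro: less_imp_le)
  from osgood_dyadic_sum[OF m] have "(\<lambda>k. 2 ^ (m + k) / \<beta>) \<longlonglongrightarrow> 0"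
    using pos b0[of "Suc (m + k)" for k] by (intro summable_LIMSEQ_zero) simp
  then have "eventually (\<lambda>k. 2 ^ (m + k) / \<beta> < 1 / \<beta>) sequentially"
    by (rule order_tendstoD(2)) (use pos in simp)
  then obtain k where "2 ^ (m + k) / \<beta> < 1 / \<beta>"
    by (auto simp: eventually_sequentially)
  then have "(2::real) ^ (m + k) < 1"
    using pos by (simp add: divide_less_cancel)
  then show False
    using one_le_power[of "2::real" "m + k"] by linarith
qed

text \<open>For large x = \<open>2 ^ k\<close> the term \<open>\<beta>\<^sup>2\<close> is absorbed
  by x b(x), and x / sqrt (x b(x)) is sqrt (x / b(x)). Up to the factor sqrt 8 these are the sides
  of the squares in the cascade, so their sum bounds the time that the cascade takes.\<close>

lemma osgood_summable: "summable (\<lambda>k. sqrt (2 ^ k / b (2 ^ k)))"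
proof -
  obtain m where m: "\<alpha> \<le> 2 ^ m"
    using real_arch_pow[of 2 \<alpha>] by (auto intro: less_imp_le)
  obtain k1 where k1: "0 < b (2 ^ k1)"
    using osgood_positive by blast
  obtain k2 where k2: "\<beta>\<^sup>2 / b (2 ^ k1) \<le> 2 ^ k2"
    using real_arch_pow[of 2 "\<beta>\<^sup>2 / b (2 ^ k1)"] by (auto intro: less_imp_le)
  let ?c = "\<lambda>k. 2 ^ (m + k) / sqrt (\<beta>\<^sup>2 + 2 * (2 ^ (m + Suc k) * b (2 ^ (m + Suc k))))"
  have "summable (\<lambda>k. sqrt (2 ^ (k + Suc m) / b (2 ^ (k + Suc m))))"
  proof (rule summable_comparison_test_ev)
    show "summable (\<lambda>k. 4 * ?c k)"
      by (intro summable_mult osgood_dyadic_sum m)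
    \<comment> \<open>One factor 2 comes from absorbing \<open>\<beta>\<^sup>2\<close>, the other
      from the numerator of \<open>?c k\<close>, which is x / 2. The index \<open>k1\<close> makes
      \<open>b\<close> positive at x and \<open>k2\<close> makes x large against
      \<open>\<beta>\<^sup>2 / b (2 ^ k1)\<close>.\<close>
    have "norm (sqrt (2 ^ (k + Suc m) / b (2 ^ (k + Suc m)))) \<le> 4 * ?c k" if "k \<ge> k1 + k2" for k
    proof -
      define x :: real where "x = 2 ^ (k + Suc m)"
      define B where "B = b x"
      have x: "1 \<le> x" "2 ^ k1 \<le> x" "2 ^ k2 \<le> x"
        using that unfolding x_def by (intro power_increasing one_le_power; simp)+
      have B: "b (2 ^ k1) \<le> B" "0 < B"
        using monoD[OF mono x(2)] k1 unfolding B_def by auto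
      have "\<beta>\<^sup>2 \<le> 2 ^ k2 * b (2 ^ k1)"
        using k2 k1 by (simp add: field_simps)
      also have "\<dots> \<le> x * B"
        using x B k1 by (intro mult_mono) auto
      finally have "\<beta>\<^sup>2 \<le> x * B" .
      moreover have "0 < x * B"
        using x(1) B(2) by simp
      ultimately have "\<beta>\<^sup>2 + 2 * (x * B) \<le> 4 * (x * B)"
        by linarith
      then have le: "sqrt (\<beta>\<^sup>2 + 2 * (x * B)) \<le> 2 * sqrt (x * B)"
        by (metis real_sqrt_four real_sqrt_le_mono real_sqrt_mult)
      have "0 < \<beta>\<^sup>2 + 2 * (x * B)"
        using pos x B by (intro add_pos_nonneg) auto
      then have "x / (2 * sqrt (x * B)) \<le> x / sqrt (\<beta>\<^sup>2 + 2 * (x * B))"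
        using x le by (intro divide_left_mono) (auto intro!: mult_pos_pos simp: B(2))
      moreover have "sqrt (x / B) = x / sqrt (x * B)"
        using x B by (simp add: real_sqrt_divide real_sqrt_mult real_div_sqrt field_simps)
      ultimately have "sqrt (x / B) \<le> 2 * (x / sqrt (\<beta>\<^sup>2 + 2 * (x * B)))"
        by simp
      moreover have "0 \<le> sqrt (x / B)"
        using x B by simp
      moreover have e: "2 ^ (m + k) = x / 2" "2 ^ (m + Suc k) = x" "2 ^ (k + Suc m) = x"
        by (simp_all add: x_def ac_simps)
      ultimately show ?thesis
        unfolding e B_def[symmetric] by simp
    qed
    then show "eventually (\<lambda>k. norm (sqrt (2 ^ (k + Suc m) / b (2 ^ (k + Suc m)))) \<le> 4 * ?c k) sequentially"
      unfolding eventually_sequentially by blast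
  qed
  then show ?thesis
    by (subst (asm) summable_iff_shift)
qed

end

section \<open>Light cones and the wave kernel\<close>

definition light_cone :: "real \<Rightarrow> real \<Rightarrow> (real \<times> real) set" where
  "light_cone t x = {(s, y). 0 < s \<and> s < t \<and> \<bar>x - y\<bar> < t - s}"

lemma mem_light_cone: "(s, y) \<in> light_cone t x \<longleftrightarrow> 0 < s \<and> s < t \<and> \<bar>x - y\<bar> < t - s"
  by (simp add: light_cone_def)

lemma sets_light_cone [measurable]: "light_cone t x \<in> sets borel"
proof -
  have "open {q :: real \<times> real. 0 < fst q \<and> fst q < t \<and> \<bar>x - snd q\<bar> < t - fst q}"
    by (intro open_Collect_conj open_Collect_less continuous_intros)
  moreover have "light_cone t x = {q. 0 < fst q \<and> fst q < t \<and> \<bar>x - snd q\<bar> < t - fst q}"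
    by (auto simp: light_cone_def)
  ultimately show ?thesis by simp
qed

lemma emeasure_lborel_rectangle:
  fixes a b c d :: real
  assumes "a \<le> b" "c \<le> d"
  shows "emeasure lborel ({a..b} \<times> {c..d}) = ennreal ((b - a) * (d - c))"
proof -
  have "emeasure lborel ({a..b} \<times> {c..d}) = emeasure lborel {a..b} * emeasure lborel {c..d}"
    by (subst lborel_prod[symmetric], subst lborel.emeasure_pair_measure_Times) auto
  also have "\<dots> = ennreal ((b - a) * (d - c))"
    using assms by (simp add: ennreal_mult)
  finally show ?thesis .
qed

lemma sets_rectangle [measurable]: "{a..b} \<times> {c..d} \<in> sets (borel :: (real \<times> real) measure)"
  by (intro borel_closed closed_Times) auto

lemma light_cone_noise_sets: "light_cone t x \<in> noise_sets"
proof (cases "0 \<le> t")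
  case True
  have "light_cone t x \<subseteq> {0..t} \<times> {x - t..x + t}"
    by (auto simp: light_cone_def)
  then have "emeasure lborel (light_cone t x) \<le> emeasure lborel ({0..t} \<times> {x - t..x + t})"
    by (intro emeasure_mono) auto
  also have "\<dots> < \<infinity>"
    using True by (subst emeasure_lborel_rectangle) auto
  finally show ?thesis
    by (intro noise_setsI sets_light_cone) (auto simp: light_cone_def)
next
  case False
  then have "light_cone t x = {}" by (auto simp: light_cone_def)
  then show ?thesis by (simp add: noise_sets_def)
qed

text \<open>The triangle has area t^2. An outer rectangle gives 2 t^2; an inner one, at times up to
  t/2 where the slice has half-width at least t/2 > t/3, gives t^2/4. Only the order of magnitude
  matters later.\<close>

lemma measure_light_cone_bounds:
  assumes "0 \<le> t"
  shows "t\<^sup>2 / 4 \<le> measure lborel (light_cone t x)" "measure lborel (light_cone t x) \<le> 2 * t\<^sup>2"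
proof -
  have fin: "light_cone t x \<in> fmeasurable lborel"
    using light_cone_noise_sets noise_sets_fmeasurable by blast
  have rect: "measure lborel ({a..b} \<times> {c..d}) = (b - a) * (d - c)" "{a..b} \<times> {c..d} \<in> fmeasurable lborel"
    if "a \<le> b" "c \<le> d" for a b c d :: real
    using emeasure_lborel_rectangle[OF that] that by (auto simp: measure_def fmeasurable_def)
  have "measure lborel (light_cone t x) \<le> measure lborel ({0..t} \<times> {x - t..x + t})"
    using assms rect fin by (intro measure_mono_fmeasurable) (auto simp: light_cone_def)
  then show "measure lborel (light_cone t x) \<le> 2 * t\<^sup>2"
    using assms by (subst (asm) rect(1)) (auto simp: power2_eq_square)
  show "t\<^sup>2 / 4 \<le> measure lborel (light_cone t x)"
  proof (cases "t = 0")
    case False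
    have "measure lborel ({t/8..t/2} \<times> {x - t/3..x + t/3}) \<le> measure lborel (light_cone t x)"
      using assms False rect(2)[of "t/8" "t/2" "x - t/3" "x + t/3"] fin
      by (intro measure_mono_fmeasurable) (auto simp: light_cone_def fmeasurable_def)
    then show ?thesis
      using assms by (subst (asm) rect(1)) (auto simp: power2_eq_square)
  qed auto
qed

section \<open>The wave kernel and the contribution of the initial data\<close>

lemma G3_eq_indicator_light_cone:
  "0 < s \<Longrightarrow> s \<le> t \<Longrightarrow> G3 (t - s) x y = 1 / 2 * indicator (light_cone t x) (s, y)"
  by (auto simp: G3_def light_cone_def indicator_def)

lemma initial_velocity_term_nonneg:
  "(\<And>y. 0 \<le> v0 y) \<Longrightarrow> 0 \<le> (LINT y|lborel. G3 t x y * v0 y)"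
  by (intro Bochner_Integration.integral_nonneg) (simp add: G3_def)

text \<open>The value of \<open>deriv\<close> says nothing where no derivative exists, so the sign
  has to come from an explicit derivative. With an antiderivative \<open>U\<close> of
  \<open>u0\<close> it is d'Alembert's mean of \<open>u0\<close> at x + t and x - t. The window of
  radius 2 t leaves room for r on both sides of t.\<close>

lemma initial_position_term_nonneg:
  assumes cont: "continuous_on UNIV u0" and nonneg: "\<And>y. 0 \<le> u0 y" and t: "0 < t"
  shows "0 \<le> deriv (\<lambda>r. LINT y|lborel. G3 r x y * u0 y) t"
proof -
  let ?p = "x - 2 * t" and ?q = "x + 2 * t"
  obtain U where U: "\<And>y. y \<in> {?p..?q} \<Longrightarrow> (U has_vector_derivative u0 y) (at y within {?p..?q})"
    using antiderivative_continuous[of ?p ?q u0] cont continuous_on_subset by blast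
  have eq: "(LINT y|lborel. G3 r x y * u0 y) = (U (x + r) - U (x - r)) / 2" if r: "r \<in> {0<..<2 * t}" for r
  proof -
    have "(LINT y|lborel. G3 r x y * u0 y) = (LINT y|lborel. 1 / 2 * (indicator {x - r..x + r} y *\<^sub>R u0 y))"
    proof (rule integral_cong_AE)
      have "AE y in lborel. y \<noteq> x - r" "AE y in lborel. y \<noteq> x + r"
        by (rule AE_lborel_singleton)+
      then show "AE y in lborel. G3 r x y * u0 y = 1 / 2 * (indicator {x - r..x + r} y *\<^sub>R u0 y)"
        by eventually_elim (auto simp: G3_def indicator_def)
      have [measurable]: "u0 \<in> borel_measurable borel"
        using cont by (rule borel_measurable_continuous_onI)
      show "(\<lambda>y. G3 r x y * u0 y) \<in> borel_measurable lborel"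
        unfolding G3_def by measurable
      show "(\<lambda>y. 1 / 2 * (indicator {x - r..x + r} y *\<^sub>R u0 y)) \<in> borel_measurable lborel"
        by measurable
    qed
    also have "\<dots> = 1 / 2 * (LINT y|lborel. indicator {x - r..x + r} y *\<^sub>R u0 y)"
      by simp
    also have "(LINT y|lborel. indicator {x - r..x + r} y *\<^sub>R u0 y) = U (x + r) - U (x - r)"
    proof (rule integral_FTC_atLeastAtMost)
      show "continuous_on {x - r..x + r} u0"
        using cont continuous_on_subset by blast
      fix y assume "x - r \<le> y" "y \<le> x + r"
      then have "(U has_vector_derivative u0 y) (at y within {?p..?q})"
        using r by (intro U) auto
      then show "(U has_vector_derivative u0 y) (at y within {x - r..x + r})"
        using r by (elim has_vector_derivative_within_subset) auto
    qed (use r in auto)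
    finally show ?thesis by simp
  qed
  have dU: "(U has_field_derivative u0 y) (at y)" if "y \<in> {?p<..<?q}" for y
  proof -
    have "at y within {?p..?q} = at y"
      using that by (intro at_within_interior) auto
    then show ?thesis
      using U[of y] that by (auto simp: has_real_derivative_iff_has_vector_derivative)
  qed
  have "((\<lambda>r. (U (x + r) - U (x - r)) / 2) has_field_derivative (u0 (x + t) + u0 (x - t)) / 2) (at t)"
    using t by (auto intro!: derivative_eq_intros DERIV_chain'[OF _ dU])
  then have "((\<lambda>r. LINT y|lborel. G3 r x y * u0 y) has_field_derivative (u0 (x + t) + u0 (x - t)) / 2) (at t)"
    using eq t by (subst DERIV_cong_ev[OF refl _ refl])
      (auto simp: eventually_nhds intro!: exI[of _ "{0<..<2 * t}"])
  then have "deriv (\<lambda>r. LINT y|lborel. G3 r x y * u0 y) t = (u0 (x + t) + u0 (x - t)) / 2"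
    by (rule DERIV_imp_deriv)
  moreover have "0 \<le> (u0 (x + t) + u0 (x - t)) / 2"
    using nonneg[of "x + t"] nonneg[of "x - t"] by simp
  ultimately show ?thesis by simp
qed

text \<open>Fubini, then Markov's inequality for the measure of the points of \<open>Q\<close> with \<open>g q \<omega> < c\<close>.\<close>

lemma (in prob_space) prob_integral_small_le:
  fixes g :: "real \<times> real \<Rightarrow> 'a \<Rightarrow> ennreal"
  assumes g [measurable]: "(\<lambda>(q, \<omega>). g q \<omega>) \<in> borel_measurable (lborel \<Otimes>\<^sub>M M)"
    and E [measurable]: "E \<in> events"
    and Q [measurable]: "Q \<in> sets borel" and A: "emeasure lborel Q = ennreal A" "0 < A"
    and le: "\<And>q. q \<in> Q \<Longrightarrow> prob {\<omega> \<in> E. g q \<omega> < ennreal c} \<le> e" and e: "0 \<le> e"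
  shows "prob {\<omega> \<in> E. (\<integral>\<^sup>+q\<in>Q. g q \<omega> \<partial>lborel) < ennreal (c * A / 2)} \<le> 2 * e"
proof (cases "0 < c")
  \<comment> \<open>The threshold is then 0 as an extended nonnegative number, so the event is
    empty.\<close>
  case False
  then have "c * A / 2 \<le> 0"
    using A by (simp add: mult_nonpos_nonneg)
  then show ?thesis
    using e by (simp add: ennreal_neg)
next
  case c: True
  interpret pair_sigma_finite lborel M ..
  define B where "B q \<omega> = (indicator E \<omega> * (if g q \<omega> < ennreal c then 1 else 0) :: ennreal)" for q \<omega>
  have [measurable]: "(\<lambda>(q, \<omega>). B q \<omega>) \<in> borel_measurable (lborel \<Otimes>\<^sub>M M)"
    unfolding B_def by measurable
  define h where "h \<omega> = (\<integral>\<^sup>+q. B q \<omega> * indicator Q q \<partial>lborel)" for \<omega>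
  have [measurable]: "h \<in> borel_measurable M"
    unfolding h_def by measurable
  have BE: "(\<integral>\<^sup>+\<omega>. B q \<omega> \<partial>M) \<le> ennreal e" if "q \<in> Q" for q
  proof -
    have [measurable]: "g q \<in> borel_measurable M"
      using measurable_compose[OF measurable_Pair1', OF _ g, of q] by simp
    have "{\<omega> \<in> E. g q \<omega> < ennreal c} = {\<omega> \<in> space M. \<omega> \<in> E \<and> g q \<omega> < ennreal c}"
      using sets.sets_into_space[OF E] by auto
    then have [measurable]: "{\<omega> \<in> E. g q \<omega> < ennreal c} \<in> events"
      by simp
    have "(\<integral>\<^sup>+\<omega>. B q \<omega> \<partial>M) = (\<integral>\<^sup>+\<omega>. indicator {\<omega> \<in> E. g q \<omega> < ennreal c} \<omega> \<partial>M)"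
      by (intro nn_integral_cong) (auto simp: B_def indicator_def)
    also have "\<dots> = ennreal (prob {\<omega> \<in> E. g q \<omega> < ennreal c})"
      by (simp add: emeasure_eq_measure)
    finally show ?thesis
      using le[OF that] by (simp add: ennreal_leI)
  qed
  have "(\<integral>\<^sup>+\<omega>. h \<omega> \<partial>M) = (\<integral>\<^sup>+q. (\<integral>\<^sup>+\<omega>. B q \<omega> * indicator Q q \<partial>M) \<partial>lborel)"
    unfolding h_def by (rule Fubini') measurable
  also have "\<dots> \<le> (\<integral>\<^sup>+q. ennreal e * indicator Q q \<partial>lborel)"
    using BE by (intro nn_integral_mono) (auto simp: indicator_def)
  also have "\<dots> = ennreal (e * A)"
    using A e by (simp add: nn_integral_cmult_indicator ennreal_mult)
  finally have hle: "(\<integral>\<^sup>+\<omega>. h \<omega> \<partial>M) \<le> ennreal (e * A)" .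
  have "{\<omega> \<in> E. (\<integral>\<^sup>+q\<in>Q. g q \<omega> \<partial>lborel) < ennreal (c * A / 2)} \<subseteq> {\<omega> \<in> space M. 1 \<le> ennreal (2 / A) * h \<omega>}"
  proof (intro subsetI CollectI conjI; elim CollectE conjE)
    fix \<omega> assume \<omega>: "\<omega> \<in> E" and lt: "(\<integral>\<^sup>+q\<in>Q. g q \<omega> \<partial>lborel) < ennreal (c * A / 2)"
    show "\<omega> \<in> space M"
      using \<omega> sets.sets_into_space[OF E] by auto
    then have [measurable]: "(\<lambda>q. g q \<omega>) \<in> borel_measurable lborel" "(\<lambda>q. B q \<omega>) \<in> borel_measurable lborel"
      using measurable_compose[OF measurable_Pair2' g, of \<omega>]
        measurable_compose[OF measurable_Pair2', of \<omega> M "\<lambda>(q, \<omega>). B q \<omega>" lborel borel] by simp_all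
    have "ennreal (c * A) = (\<integral>\<^sup>+q. ennreal c * indicator Q q \<partial>lborel)"
      using A c by (simp add: nn_integral_cmult_indicator ennreal_mult)
    \<comment> \<open>On \<open>E\<close>, at each point of \<open>Q\<close> either
      \<open>g q \<omega>\<close> is at least c or the bad indicator \<open>B q \<omega>\<close> is
      1.\<close>
    also have "\<dots> \<le> (\<integral>\<^sup>+q. g q \<omega> * indicator Q q + ennreal c * (B q \<omega> * indicator Q q) \<partial>lborel)"
      using \<omega> by (intro nn_integral_mono) (auto simp: B_def indicator_def)
    also have "\<dots> = (\<integral>\<^sup>+q\<in>Q. g q \<omega> \<partial>lborel) + ennreal c * h \<omega>"
      unfolding h_def by (subst nn_integral_add) (auto simp: nn_integral_cmult)
    finally have sum: "ennreal (c * A) \<le> (\<integral>\<^sup>+q\<in>Q. g q \<omega> \<partial>lborel) + ennreal c * h \<omega>" .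
    \<comment> \<open>If the bad points filled at most half of \<open>Q\<close>, the others alone
      would carry the mass c A / 2.\<close>
    show "1 \<le> ennreal (2 / A) * h \<omega>"
    proof (rule ccontr)
      assume "\<not> 1 \<le> ennreal (2 / A) * h \<omega>"
      then have l: "ennreal (2 / A) * h \<omega> < 1" by simp
      have "h \<omega> = ennreal (A / 2) * (ennreal (2 / A) * h \<omega>)"
        using A by (simp add: mult.assoc[symmetric] ennreal_mult[symmetric])
      also have "\<dots> \<le> ennreal (A / 2) * 1"
        using l by (intro mult_left_mono) auto
      finally have "ennreal c * h \<omega> \<le> ennreal c * ennreal (A / 2)"
        by (intro mult_left_mono) auto
      also have "\<dots> = ennreal (c * A / 2)"
        using c A by (simp add: ennreal_mult[symmetric])
      finally have "(\<integral>\<^sup>+q\<in>Q. g q \<omega> \<partial>lborel) + ennreal c * h \<omega> \<le> (\<integral>\<^sup>+q\<in>Q. g q \<omega> \<partial>lborel) + ennreal (c * A / 2)"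
        by (intro add_left_mono)
      also have "\<dots> < ennreal (c * A / 2) + ennreal (c * A / 2)"
        using lt by (subst add.commute) (simp add: ennreal_add_left_cancel_less)
      also have "\<dots> = ennreal (c * A)"
        using c A by (simp add: ennreal_plus[symmetric] del: ennreal_plus)
      finally show False
        using sum by simp
    qed
  qed
  then have "emeasure M {\<omega> \<in> E. (\<integral>\<^sup>+q\<in>Q. g q \<omega> \<partial>lborel) < ennreal (c * A / 2)} \<le>
      emeasure M {\<omega> \<in> space M. 1 \<le> ennreal (2 / A) * h \<omega>}"
    by (intro emeasure_mono) measurable
  also have "\<dots> \<le> ennreal (2 / A) * (\<integral>\<^sup>+\<omega>. h \<omega> * indicator (space M) \<omega> \<partial>M)"
    by (intro nn_integral_Markov_inequality) auto
  also have "(\<integral>\<^sup>+\<omega>. h \<omega> * indicator (space M) \<omega> \<partial>M) = (\<integral>\<^sup>+\<omega>. h \<omega> \<partial>M)"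
    by (intro nn_integral_cong) auto
  also have "ennreal (2 / A) * \<dots> \<le> ennreal (2 / A) * ennreal (e * A)"
    by (intro mult_left_mono hle) auto
  also have "\<dots> = ennreal (2 * e)"
    using A e by (simp add: ennreal_mult[symmetric])
  finally show ?thesis
    using e by (simp add: emeasure_eq_measure)
qed

section \<open>Lower bounds for the solution\<close>

locale wave_solution = white_noise_space M F W
  for M :: "'a measure" and F :: "ennreal \<Rightarrow> 'a measure" and W :: "(real \<times> real) set \<Rightarrow> 'a \<Rightarrow> real" +
  fixes b u0 v0 :: "real \<Rightarrow> real" and \<sigma> :: real
    and \<tau> :: "'a \<Rightarrow> ennreal" and u :: "real \<Rightarrow> real \<Rightarrow> 'a \<Rightarrow> real"
  assumes b_nonneg: "\<And>z. 0 \<le> b z" and b_mono: "mono b" and \<sigma>_pos: "0 < \<sigma>"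
    and u0_cont: "continuous_on UNIV u0" and u0_nonneg: "\<And>x. 0 \<le> u0 x"
    and v0_nonneg: "\<And>x. 0 \<le> v0 x"
    and solution: "local_solution M F W \<sigma> b u0 v0 \<tau> u"
begin

definition global_event :: "'a set" where
  "global_event = {\<omega> \<in> space M. \<tau> \<omega> = \<infinity>}"

text \<open>A finite value of \<tau> lies below some natural number, so the event is described by
  countably many finite times, at which \<open>stopping_time\<close> has content.\<close>

lemma sets_global_event [measurable]: "global_event \<in> events"
proof -
  have st: "stopping_time F \<tau>"
    using solution by (simp add: local_solution_def)
  have "\<tau> \<omega> = \<infinity> \<longleftrightarrow> (\<forall>n::nat. \<not> \<tau> \<omega> \<le> of_nat n)" for \<omega>
  proof (cases "\<tau> \<omega> = \<infinity>")
    case False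
    then obtain n where "\<tau> \<omega> < of_nat n"
      using ennreal_Ex_less_of_nat[of "\<tau> \<omega>"] by (auto simp: less_top)
    then show ?thesis
      using False less_imp_le by blast
  qed (simp add: top_unique)
  then have "global_event = {\<omega> \<in> space M. \<forall>n::nat. \<not> \<tau> \<omega> \<le> of_nat n}"
    by (simp add: global_event_def)
  moreover have "Measurable.pred M (\<lambda>\<omega>. \<tau> \<omega> \<le> of_nat n)" for n
    by (rule measurable_from_subalg[OF F_subalgebra stopping_timeD[OF st]])
  ultimately show ?thesis
    by (simp add: pred_def sets.sets_Collect)
qed

text \<open>The solution is measurable only where 0 < t < \<tau>. Extending it by 0 off the global
  event gives a function that is jointly measurable everywhere, as Fubini requires, and agrees with
  \<open>u\<close> wherever the argument looks at it.\<close>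

definition v :: "real \<times> real \<Rightarrow> 'a \<Rightarrow> real" where
  "v q \<omega> = (if 0 < fst q \<and> \<tau> \<omega> = \<infinity> then u (fst q) (snd q) \<omega> else 0)"

text \<open>\<open>local_solution\<close> gives measurability on the trace of \<open>?A\<close>.
  Restricting further to \<open>?B\<close>, which lies inside \<open>?A\<close> and is a measurable
  product set, makes the extension by 0 measurable.\<close>

lemma measurable_v [measurable]: "(\<lambda>(q, \<omega>). v q \<omega>) \<in> borel_measurable (lborel \<Otimes>\<^sub>M M)"
proof -
  let ?N = "borel \<Otimes>\<^sub>M borel \<Otimes>\<^sub>M M :: (real \<times> real \<times> 'a) measure"
  let ?A = "{(t :: real, x :: real, \<omega>). 0 < t \<and> ennreal t < \<tau> \<omega>}"
  let ?B = "{(t :: real, x :: real, \<omega>). 0 < t \<and> \<omega> \<in> global_event}"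
  have "(\<lambda>(t, x, \<omega>). u t x \<omega>) \<in> borel_measurable (restrict_space ?N ?A)"
    using solution by (simp add: local_solution_def)
  then have meas: "(\<lambda>(t, x, \<omega>). u t x \<omega>) \<in> borel_measurable (restrict_space (restrict_space ?N ?A) ?B)"
    by (rule measurable_restrict_space1)
  moreover have "?A \<inter> ?B = ?B"
    by (auto simp: global_event_def)
  ultimately have eq: "sets (restrict_space (restrict_space ?N ?A) ?B) = sets (restrict_space ?N ?B)"
    by (simp only: sets_restrict_restrict_space)
  have "(\<lambda>(t, x, \<omega>). u t x \<omega>) \<in> borel_measurable (restrict_space ?N ?B)"
    using meas unfolding measurable_cong_sets[OF eq refl] .
  moreover have "?B \<inter> space ?N \<in> sets ?N"
  proof -
    have "?B \<inter> space ?N = {0<..} \<times> UNIV \<times> global_event"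
      by (auto simp: space_pair_measure global_event_def)
    then show ?thesis by simp
  qed
  ultimately have "(\<lambda>p. if p \<in> ?B then (\<lambda>(t, x, \<omega>). u t x \<omega>) p else 0) \<in> borel_measurable ?N"
    by (subst measurable_restrict_space_iff[symmetric]) auto
  moreover have "(\<lambda>(q, \<omega>). (fst q, snd q, \<omega>)) \<in> measurable (lborel \<Otimes>\<^sub>M M) ?N"
  proof -
    have "sets (lborel :: (real \<times> real) measure) = sets (borel \<Otimes>\<^sub>M borel :: (real \<times> real) measure)"
      unfolding borel_prod by simp
    then have "sets (lborel \<Otimes>\<^sub>M M) = sets ((borel \<Otimes>\<^sub>M borel) \<Otimes>\<^sub>M M :: ((real \<times> real) \<times> 'a) measure)"
      by (rule sets_pair_measure_cong) simp
    then show ?thesis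
      unfolding measurable_cong_sets[OF \<open>sets (lborel \<Otimes>\<^sub>M M) = _\<close> refl] by measurable
  qed
  ultimately have "(\<lambda>p. (\<lambda>p. if p \<in> ?B then (\<lambda>(t, x, \<omega>). u t x \<omega>) p else 0) ((\<lambda>(q, \<omega>). (fst q, snd q, \<omega>)) p))
      \<in> borel_measurable (lborel \<Otimes>\<^sub>M M)"
    by (rule measurable_compose[rotated])
  then show ?thesis
    by (rule measurable_cong[THEN iffD1, rotated])
      (auto simp: v_def global_event_def space_pair_measure split: if_splits)
qed

lemma measurable_b [measurable]: "b \<in> borel_measurable borel"
  using b_mono by (rule borel_measurable_mono)

text \<open>The drift mass collected in \<open>Q\<close>. As an extended integral it keeps the value
  infinity for a divergent drift, where a Bochner integral would return 0.\<close>

definition S :: "(real \<times> real) set \<Rightarrow> 'a \<Rightarrow> ennreal" where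
  "S Q \<omega> = (\<integral>\<^sup>+q\<in>Q. ennreal (b (v q \<omega>)) \<partial>lborel)"

lemma measurable_S [measurable]:
  assumes [measurable]: "Q \<in> sets borel"
  shows "S Q \<in> borel_measurable M"
  unfolding S_def by measurable

lemma measurable_v_fixed [measurable]: "v q \<in> borel_measurable M"
  using measurable_compose[OF measurable_Pair1' measurable_v, of q] by simp

lemma S_mono: "Q \<subseteq> Q' \<Longrightarrow> S Q \<omega> \<le> S Q' \<omega>"
  unfolding S_def by (intro nn_integral_mono) (auto simp: indicator_def)

text \<open>All later use of the equation goes through this bound: the initial terms are dropped by
  sign, and the kernel is 1/2 on the cone. The real number \<open>I\<close> also records that the
  drift mass of a cone is finite, which is what the cascade contradicts. The null set depends on (t,
  x), so squares are handled through Fubini and not path by path.\<close>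

lemma solution_lower_bound:
  assumes t: "0 < t"
  shows "AE \<omega> in M. \<omega> \<in> global_event \<longrightarrow>
    (\<exists>I\<ge>0. S (light_cone t x) \<omega> = ennreal I \<and> \<sigma> / 2 * W (light_cone t x) \<omega> + I / 2 \<le> v (t, x) \<omega>)"
proof -
  let ?C = "light_cone t x"
  let ?int = "\<lambda>\<omega>. LINT (s, y):{0<..<t} \<times> UNIV|lborel. G3 (t - s) x y * b (u s y \<omega>)"
  obtain Z where walsh: "has_walsh_integral M F W t (\<lambda>s y \<omega>. G3 (t - s) x y) Z"
    and sol: "AE \<omega> in M. ennreal t < \<tau> \<omega> \<longrightarrow>
           set_integrable lborel ({0<..<t} \<times> UNIV) (\<lambda>(s, y). G3 (t - s) x y * b (u s y \<omega>)) \<and>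
           u t x \<omega> =
             (LINT y|lborel. G3 t x y * v0 y)
             + deriv (\<lambda>r. LINT y|lborel. G3 r x y * u0 y) t
             + \<sigma> * Z \<omega> + ?int \<omega>"
    using solution t unfolding local_solution_def by blast
  have "AE \<omega> in M. Z \<omega> = 1 / 2 * W ?C \<omega>"
    by (rule walsh_integral_of_indicator[OF walsh light_cone_noise_sets])
      (auto simp: light_cone_def G3_eq_indicator_light_cone[unfolded light_cone_def])
  with sol show ?thesis
  proof eventually_elim
    case (elim \<omega>)
    show ?case
    proof
      assume \<omega>: "\<omega> \<in> global_event"
      then have inf: "\<tau> \<omega> = \<infinity>" and sp: "\<omega> \<in> space M" by (auto simp: global_event_def)
      have eq: "indicator ({0<..<t} \<times> UNIV) q *\<^sub>R (case q of (s, y) \<Rightarrow> G3 (t - s) x y * b (u s y \<omega>)) =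
          1 / 2 * (indicator ?C q * b (v q \<omega>))" for q :: "real \<times> real"
        using inf by (cases q) (auto simp: light_cone_def G3_def v_def indicator_def)
      have "integrable lborel (\<lambda>q. 1 / 2 * (indicator ?C q * b (v q \<omega>)))"
        and u: "u t x \<omega> = (LINT y|lborel. G3 t x y * v0 y)
             + deriv (\<lambda>r. LINT y|lborel. G3 r x y * u0 y) t
             + \<sigma> * Z \<omega> + (LINT q|lborel. 1 / 2 * (indicator ?C q * b (v q \<omega>)))"
        using elim(1) inf unfolding set_integrable_def set_lebesgue_integral_def eq by simp_all
      from integrable_mult_right[OF this(1), of 2]
      have int: "integrable lborel (\<lambda>q. indicator ?C q * b (v q \<omega>))"
        by simp
      define I where "I = (LINT q|lborel. indicator ?C q * b (v q \<omega>))"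
      have "S ?C \<omega> = (\<integral>\<^sup>+q. ennreal (indicator ?C q * b (v q \<omega>)) \<partial>lborel)"
        unfolding S_def by (intro nn_integral_cong) (auto simp: indicator_def)
      also have "\<dots> = ennreal I"
        unfolding I_def using int by (intro nn_integral_eq_integral) (auto simp: b_nonneg)
      finally have "S ?C \<omega> = ennreal I" .
      moreover have "0 \<le> I"
        unfolding I_def by (intro Bochner_Integration.integral_nonneg) (simp add: b_nonneg)
      moreover have "\<sigma> / 2 * W ?C \<omega> + I / 2 \<le> v (t, x) \<omega>"
      proof -
        have init: "0 \<le> (LINT y|lborel. G3 t x y * v0 y)"
          by (intro initial_velocity_term_nonneg v0_nonneg)
        have "v (t, x) \<omega> = u t x \<omega>"
          using t inf by (simp add: v_def)
        moreover have "(LINT q|lborel. 1 / 2 * (indicator ?C q * b (v q \<omega>))) = I / 2"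
          by (simp add: I_def)
        moreover have "\<sigma> * Z \<omega> = \<sigma> / 2 * W ?C \<omega>"
          using elim(2) by simp
        ultimately show ?thesis
          using u init
            initial_position_term_nonneg[OF u0_cont u0_nonneg t, of x] by linarith
      qed
      ultimately show "\<exists>I\<ge>0. S ?C \<omega> = ennreal I \<and> \<sigma> / 2 * W ?C \<omega> + I / 2 \<le> v (t, x) \<omega>"
        by blast
    qed
  qed
qed

text \<open>
  At a point that sees all of \<open>Q\<close> the solution falls below \<open>Y / 2 - G\<close> only if the noise term is
  below \<open>- G\<close>, which Chebyshev's inequality makes unlikely.
\<close>

lemma drift_mass_step:
  assumes [measurable]: "Q \<in> sets borel" "Q' \<in> sets borel"
    and A: "emeasure lborel Q' = ennreal A" "0 < A"
    and sub: "\<And>t x. (t, x) \<in> Q' \<Longrightarrow> 0 < t \<and> t \<le> T \<and> Q \<subseteq> light_cone t x"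
    and Y: "0 \<le> Y" and G: "0 < G"
  shows "prob {\<omega> \<in> global_event. ennreal Y \<le> S Q \<omega> \<and> S Q' \<omega> < ennreal (b (Y / 2 - G) * A / 2)}
    \<le> \<sigma>\<^sup>2 * T\<^sup>2 / G\<^sup>2"
proof -
  let ?E = "{\<omega> \<in> space M. \<omega> \<in> global_event \<and> ennreal Y \<le> S Q \<omega>}"
  have E [measurable]: "?E \<in> events" by measurable
  have le: "prob {\<omega> \<in> ?E. ennreal (b (v q \<omega>)) < ennreal (b (Y / 2 - G))} \<le> \<sigma>\<^sup>2 * T\<^sup>2 / (2 * G\<^sup>2)"
    if q: "q \<in> Q'" for q
  proof -
    obtain t x where tx: "q = (t, x)" by (cases q)
    let ?C = "light_cone t x"
    have t: "0 < t" "t \<le> T" "Q \<subseteq> ?C"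
      using sub[of t x] q tx by auto
    note [measurable] = noise_measurable[OF light_cone_noise_sets[of t x]]
    have "AE \<omega> in M. \<omega> \<in> {\<omega> \<in> ?E. ennreal (b (v q \<omega>)) < ennreal (b (Y / 2 - G))} \<longrightarrow>
        \<omega> \<in> {\<omega> \<in> space M. 2 * G / \<sigma> \<le> \<bar>W ?C \<omega>\<bar>}"
      using solution_lower_bound[OF t(1), of x]
    proof eventually_elim
      case (elim \<omega>)
      show ?case
      proof (intro impI CollectI conjI; elim CollectE conjE)
        assume \<omega>: "\<omega> \<in> space M" "\<omega> \<in> global_event" "ennreal Y \<le> S Q \<omega>"
          and lt: "ennreal (b (v q \<omega>)) < ennreal (b (Y / 2 - G))"
        show "\<omega> \<in> space M" by fact
        obtain I where I: "0 \<le> I" "S ?C \<omega> = ennreal I" "\<sigma> / 2 * W ?C \<omega> + I / 2 \<le> v (t, x) \<omega>"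
          using elim \<omega> by blast
        have "ennreal Y \<le> ennreal I"
          using \<omega>(3) S_mono[OF t(3), of \<omega>] I(2) by (auto intro: order_trans)
        then have "Y \<le> I"
          using I(1) by simp
        have "b (v q \<omega>) < b (Y / 2 - G)"
          using lt b_nonneg by (simp add: ennreal_less_iff)
        then have "v q \<omega> < Y / 2 - G"
          using monoD[OF b_mono, of "Y / 2 - G" "v q \<omega>"] by (meson not_less)
        then have "\<sigma> / 2 * W ?C \<omega> < - G"
          using I(3) \<open>Y \<le> I\<close> tx by simp
        then have "2 * G / \<sigma> \<le> - W ?C \<omega>"
          using \<sigma>_pos by (simp add: field_simps)
        then show "2 * G / \<sigma> \<le> \<bar>W ?C \<omega>\<bar>"
          by simp
      qed
    qed
    then have "prob {\<omega> \<in> ?E. ennreal (b (v q \<omega>)) < ennreal (b (Y / 2 - G))} \<le>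
        prob {\<omega> \<in> space M. 2 * G / \<sigma> \<le> \<bar>W ?C \<omega>\<bar>}"
      by (intro finite_measure_mono_AE) auto
    also have "\<dots> \<le> expectation (\<lambda>\<omega>. (W ?C \<omega>)\<^sup>2) / (2 * G / \<sigma>)\<^sup>2"
      using G \<sigma>_pos by (intro second_moment_method noise_sq_integrable light_cone_noise_sets) auto
    also have "expectation (\<lambda>\<omega>. (W ?C \<omega>)\<^sup>2) = measure lborel ?C"
      by (rule noise_sq[OF light_cone_noise_sets])
    also have "measure lborel ?C / (2 * G / \<sigma>)\<^sup>2 \<le> 2 * T\<^sup>2 / (2 * G / \<sigma>)\<^sup>2"
    proof (intro divide_right_mono)
      have "t\<^sup>2 \<le> T\<^sup>2"
        using t by (intro power_mono) auto
      then show "measure lborel ?C \<le> 2 * T\<^sup>2"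
        using measure_light_cone_bounds(2)[of t x] t by linarith
    qed simp
    also have "\<dots> = \<sigma>\<^sup>2 * T\<^sup>2 / (2 * G\<^sup>2)"
      using \<sigma>_pos G by (simp add: field_simps power2_eq_square)
    finally show ?thesis .
  qed
  \<comment> \<open>The factor 2 lost in Fubini and Markov cancels the 2 in the denominator of the
    pointwise bound.\<close>
  have "prob {\<omega> \<in> ?E. (\<integral>\<^sup>+q\<in>Q'. ennreal (b (v q \<omega>)) \<partial>lborel) < ennreal (b (Y / 2 - G) * A / 2)}
      \<le> 2 * (\<sigma>\<^sup>2 * T\<^sup>2 / (2 * G\<^sup>2))"
    by (rule prob_integral_small_le[OF _ E _ A le]) auto
  moreover have "{\<omega> \<in> ?E. (\<integral>\<^sup>+q\<in>Q'. ennreal (b (v q \<omega>)) \<partial>lborel) < ennreal (b (Y / 2 - G) * A / 2)} =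
      {\<omega> \<in> global_event. ennreal Y \<le> S Q \<omega> \<and> S Q' \<omega> < ennreal (b (Y / 2 - G) * A / 2)}"
    by (auto simp: S_def global_event_def)
  ultimately show ?thesis
    by simp
qed

end

section \<open>Starting the cascade\<close>

context white_noise_space
begin

lemma noise_exp:
  assumes A: "A \<in> noise_sets"
  shows "integrable M (\<lambda>\<omega>. exp (\<mu> * W A \<omega>))"
    and "expectation (\<lambda>\<omega>. exp (\<mu> * W A \<omega>)) = exp (\<mu>\<^sup>2 * measure lborel A / 2)"
proof -
  have g: "centered_gaussian M (\<lambda>\<omega>. \<mu> * W A \<omega>)"
    using noise_gaussian[of "{A}" "\<lambda>_. \<mu>"] A by simp
  show "integrable M (\<lambda>\<omega>. exp (\<mu> * W A \<omega>))"
    by (rule centered_gaussian_exp(1)[OF g])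
  show "expectation (\<lambda>\<omega>. exp (\<mu> * W A \<omega>)) = exp (\<mu>\<^sup>2 * measure lborel A / 2)"
    using centered_gaussian_exp(2)[OF g] noise_sq[OF A] by (simp add: power_mult_distrib)
qed

text \<open>The product is almost surely the exponential of the noise of the union, whose measure is
  the sum of the two.\<close>

lemma noise_exp_uncorrelated:
  assumes A: "A \<in> noise_sets" and B: "B \<in> noise_sets" and disj: "A \<inter> B = {}"
  shows "integrable M (\<lambda>\<omega>. exp (\<mu> * W A \<omega>) * exp (\<mu> * W B \<omega>))"
    and "expectation (\<lambda>\<omega>. exp (\<mu> * W A \<omega>) * exp (\<mu> * W B \<omega>)) =
      exp (\<mu>\<^sup>2 * measure lborel A / 2) * exp (\<mu>\<^sup>2 * measure lborel B / 2)"
proof -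
  note U = noise_sets_Un[OF A B]
  note [measurable] = noise_measurable[OF A] noise_measurable[OF B] noise_measurable[OF U]
  have ae: "AE \<omega> in M. exp (\<mu> * W A \<omega>) * exp (\<mu> * W B \<omega>) = exp (\<mu> * W (A \<union> B) \<omega>)"
    using noise_add[OF A B disj] by eventually_elim (simp add: exp_add[symmetric] distrib_left)
  show "integrable M (\<lambda>\<omega>. exp (\<mu> * W A \<omega>) * exp (\<mu> * W B \<omega>))"
    by (subst integrable_cong_AE[OF _ _ ae]) (auto intro: noise_exp(1)[OF U])
  have "measure lborel (A \<union> B) = measure lborel A + measure lborel B"
    using A B disj by (intro measure_Union) (auto simp: noise_sets_def)
  then show "expectation (\<lambda>\<omega>. exp (\<mu> * W A \<omega>) * exp (\<mu> * W B \<omega>)) =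
      exp (\<mu>\<^sup>2 * measure lborel A / 2) * exp (\<mu>\<^sup>2 * measure lborel B / 2)"
    by (subst integral_cong_AE[OF _ _ ae])
      (auto simp: noise_exp(2)[OF U] exp_add[symmetric] algebra_simps add_divide_distrib)
qed

text \<open>
  Disjoint sets give independent values of the noise; the exponentials are uncorrelated because
  the sum of the values is Gaussian, so no joint law is needed for this weak law of large numbers.
\<close>

lemma noise_exp_sum_deviation:
  assumes fin: "finite I" and A: "\<And>i. i \<in> I \<Longrightarrow> A i \<in> noise_sets"
    and disj: "disjoint_family_on A I" and m: "\<And>i. i \<in> I \<Longrightarrow> measure lborel (A i) \<le> m"
    and a: "0 < a"
  shows "prob {\<omega> \<in> space M. a \<le> \<bar>\<Sum>i\<in>I. exp (\<mu> * W (A i) \<omega>) - exp (\<mu>\<^sup>2 * measure lborel (A i) / 2)\<bar>}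
    \<le> card I * exp (2 * \<mu>\<^sup>2 * m) / a\<^sup>2"
proof -
  define E where "E i = exp (\<mu>\<^sup>2 * measure lborel (A i) / 2)" for i
  define D where "D i \<omega> = exp (\<mu> * W (A i) \<omega>) - E i" for i \<omega>
  have DD: "integrable M (\<lambda>\<omega>. D i \<omega> * D j \<omega>)"
    "expectation (\<lambda>\<omega>. D i \<omega> * D j \<omega>) \<le> (if i = j then exp (2 * \<mu>\<^sup>2 * m) else 0)"
    if "i \<in> I" "j \<in> I" for i j
  proof -
    have eq: "D i \<omega> * D j \<omega> = exp (\<mu> * W (A i) \<omega>) * exp (\<mu> * W (A j) \<omega>)
        - E j * exp (\<mu> * W (A i) \<omega>) - E i * exp (\<mu> * W (A j) \<omega>) + E i * E j" for \<omega>
      by (simp add: D_def algebra_simps)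
    \<comment> \<open>A diagonal term is an exponential moment with parameter 2 \<mu>, whence the
      bound \<open>exp (2 * \<mu>\<^sup>2 * m)\<close>.\<close>
    have sq: "exp (\<mu> * W (A i) \<omega>) * exp (\<mu> * W (A i) \<omega>) = exp ((2 * \<mu>) * W (A i) \<omega>)" for \<omega>
      by (simp add: exp_add[symmetric])
    have int: "integrable M (\<lambda>\<omega>. exp (\<mu> * W (A i) \<omega>) * exp (\<mu> * W (A j) \<omega>))"
    proof (cases "i = j")
      case True
      show ?thesis
        using noise_exp(1)[OF A[OF that(1)], of "2 * \<mu>"] unfolding True[symmetric] sq .
    next
      case False
      then show ?thesis
        using that disj by (intro noise_exp_uncorrelated(1) A) (auto simp: disjoint_family_on_def)
    qed
    note ints = int noise_exp(1)[OF A[OF that(1)], of \<mu>] noise_exp(1)[OF A[OF that(2)], of \<mu>]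
    show "integrable M (\<lambda>\<omega>. D i \<omega> * D j \<omega>)"
      unfolding eq using ints by simp
    have "expectation (\<lambda>\<omega>. D i \<omega> * D j \<omega>) =
        expectation (\<lambda>\<omega>. exp (\<mu> * W (A i) \<omega>) * exp (\<mu> * W (A j) \<omega>)) - E i * E j"
      unfolding eq using ints noise_exp(2)[OF A[OF that(1)], of \<mu>] noise_exp(2)[OF A[OF that(2)], of \<mu>]
      by (simp add: E_def prob_space)
    also have "\<dots> \<le> (if i = j then exp (2 * \<mu>\<^sup>2 * m) else 0)"
    proof (cases "i = j")
      case True
      have "expectation (\<lambda>\<omega>. exp (\<mu> * W (A i) \<omega>) * exp (\<mu> * W (A j) \<omega>)) =
          exp ((2 * \<mu>)\<^sup>2 * measure lborel (A i) / 2)"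
        unfolding True[symmetric] sq by (rule noise_exp(2)[OF A[OF that(1)]])
      also have "\<dots> \<le> exp (2 * \<mu>\<^sup>2 * m)"
        using mult_left_mono[OF m[OF that(1)], of "2 * \<mu>\<^sup>2"] by (simp add: power_mult_distrib mult.commute)
      finally have "expectation (\<lambda>\<omega>. exp (\<mu> * W (A i) \<omega>) * exp (\<mu> * W (A j) \<omega>)) \<le> exp (2 * \<mu>\<^sup>2 * m)" .
      moreover have "0 \<le> E i * E j"
        by (simp add: E_def)
      ultimately have "expectation (\<lambda>\<omega>. exp (\<mu> * W (A i) \<omega>) * exp (\<mu> * W (A j) \<omega>)) - E i * E j
          \<le> exp (2 * \<mu>\<^sup>2 * m)"
        by linarith
      then show ?thesis
        using True by simp
    next
      case False
      then have "A i \<inter> A j = {}"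
        using that disj by (auto simp: disjoint_family_on_def)
      then show ?thesis
        using False noise_exp_uncorrelated(2)[OF A[OF that(1)] A[OF that(2)], of \<mu>]
        by (simp add: E_def)
    qed
    finally show "expectation (\<lambda>\<omega>. D i \<omega> * D j \<omega>) \<le> (if i = j then exp (2 * \<mu>\<^sup>2 * m) else 0)" .
  qed
  have [measurable]: "D i \<in> borel_measurable M" if "i \<in> I" for i
    using noise_measurable[OF A[OF that]] unfolding D_def by measurable
  have sq: "(\<Sum>i\<in>I. D i \<omega>)\<^sup>2 = (\<Sum>i\<in>I. \<Sum>j\<in>I. D i \<omega> * D j \<omega>)" for \<omega>
    by (simp add: power2_eq_square sum_product)
  have "prob {\<omega> \<in> space M. a \<le> \<bar>\<Sum>i\<in>I. D i \<omega>\<bar>} \<le> expectation (\<lambda>\<omega>. (\<Sum>i\<in>I. D i \<omega>)\<^sup>2) / a\<^sup>2"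
    using a by (intro second_moment_method) (auto simp: sq DD intro!: borel_measurable_sum)
  also have "expectation (\<lambda>\<omega>. (\<Sum>i\<in>I. D i \<omega>)\<^sup>2) \<le> (\<Sum>i\<in>I. \<Sum>j\<in>I. if i = j then exp (2 * \<mu>\<^sup>2 * m) else 0)"
    using DD by (simp add: sq sum_mono)
  also have "\<dots> = card I * exp (2 * \<mu>\<^sup>2 * m)"
    using fin by simp
  finally show ?thesis
    using a by (simp add: D_def E_def divide_right_mono)
qed

end

lemma indicator_leI: "(x \<in> A \<Longrightarrow> x \<in> B) \<Longrightarrow> indicator A x \<le> (indicator B x :: ennreal)"
  by (auto simp: indicator_def)

lemma light_cone_disjoint:
  assumes "t \<le> r" "2 * r \<le> \<bar>x - x'\<bar>"
  shows "light_cone t x \<inter> light_cone t x' = {}"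
  using assms by (auto simp: light_cone_def)

context wave_solution
begin

text \<open>
  The indicator of \<open>z \<ge> N ln (17/16)\<close> dominates \<open>4 e (exp (z/N) - 17/16 - e (exp (z/N))\<^sup>2)\<close>, and the
  sum of the latter over \<open>K\<close> disjoint light cones of height between \<open>N\<close> and \<open>2 N\<close> concentrates.
\<close>

lemma drift_column_sum:
  assumes z0: "0 < b z0"
  obtains c C N0 :: real where "0 < c" "0 < C" "0 < N0"
    "\<And>N K t x. N0 \<le> N \<Longrightarrow> 0 < K \<Longrightarrow> N \<le> t \<Longrightarrow> t \<le> 2 * N \<Longrightarrow>
      prob {\<omega> \<in> global_event. (\<Sum>k<K. b (v (t, x + 4 * N * real k) \<omega>)) < c * real K} \<le> C / real K"
proof -
  \<comment> \<open>The cone area is at least N^2/4, so exp (W/N) has mean at least 1 + 1/8. The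
    threshold 17/16 sits halfway between 1 and that bound.\<close>
  define a where "a = ln (17 / 16 :: real)"
  have a: "0 < a" "exp a = 17 / 16" by (simp_all add: a_def)
  \<comment> \<open>The cone area is at most 8 N^2, so exp (2W/N) has mean at most
    \<open>exp 16\<close>; this choice makes the quadratic correction cost at most 1/64 on
    average.\<close>
  define e :: real where "e = exp (- 16) / 64"
  have e: "0 < e" by (simp add: e_def)
  \<comment> \<open>Makes noise of size N a lift the solution to \<open>z0\<close>: \<sigma>/2 * N *
    a is at least \<open>z0\<close>.\<close>
  define N0 where "N0 = max 1 (2 * z0 / (\<sigma> * a))"
  define c where "c = e * b z0 / 16"
  \<comment> \<open>The two Chebyshev bounds: 64^2 exp 16 for the parameter 1/N, and exp 64 * (64
    e)^2 = exp 32 for 2/N.\<close>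
  define C :: real where "C = 4096 * exp 16 + exp 32"
  have "prob {\<omega> \<in> global_event. (\<Sum>k<K. b (v (t, x + 4 * N * real k) \<omega>)) < c * real K} \<le> C / real K"
    if N: "N0 \<le> N" and K: "0 < K" and t: "N \<le> t" "t \<le> 2 * N" for N t x :: real and K :: nat
  proof -
    have N1: "1 \<le> N" and Nz: "2 * z0 / (\<sigma> * a) \<le> N" using N by (auto simp: N0_def)
    \<comment> \<open>Cones of height at most 2 N have half-width at most 2 N, so centres 4 N apart
      keep them disjoint.\<close>
    define A where "A k = light_cone t (x + 4 * N * real k)" for k
    have An: "A k \<in> noise_sets" for k
      unfolding A_def by (rule light_cone_noise_sets)
    have disj: "disjoint_family_on A {..<K}"
    proof -
      have "A i \<inter> A j = {}" if "i \<noteq> j" for i j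
        unfolding A_def
      proof (rule light_cone_disjoint[OF t(2)])
        have "1 \<le> \<bar>real i - real j\<bar>"
          using that by linarith
        then have "4 * N * 1 \<le> 4 * N * \<bar>real i - real j\<bar>"
          using N1 by (intro mult_left_mono) auto
        also have "\<dots> = \<bar>x + 4 * N * real i - (x + 4 * N * real j)\<bar>"
          using N1 by (simp add: abs_mult right_diff_distrib[symmetric])
        finally show "2 * (2 * N) \<le> \<bar>x + 4 * N * real i - (x + 4 * N * real j)\<bar>"
          by simp
      qed
      then show ?thesis by (auto simp: disjoint_family_on_def)
    qed
    have Am: "N\<^sup>2 / 4 \<le> measure lborel (A k)" "measure lborel (A k) \<le> 8 * N\<^sup>2" for k
    proof -
      have "N\<^sup>2 \<le> t\<^sup>2" "t\<^sup>2 \<le> 4 * N\<^sup>2"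
        using power_mono[of N t 2] power_mono[of t "2 * N" 2] N1 t by simp_all
      then show "N\<^sup>2 / 4 \<le> measure lborel (A k)" "measure lborel (A k) \<le> 8 * N\<^sup>2"
        using measure_light_cone_bounds[of t "x + 4 * N * real k"] N1 t unfolding A_def
        by linarith+
    qed
    define m where "m \<mu> k = exp (\<mu>\<^sup>2 * measure lborel (A k) / 2)" for \<mu> k
    define X where "X \<mu> \<omega> = (\<Sum>k<K. exp (\<mu> * W (A k) \<omega>) - m \<mu> k)" for \<mu> \<omega>
    note [measurable] = noise_measurable[OF An]
    have [measurable]: "X \<mu> \<in> borel_measurable M" for \<mu>
      unfolding X_def by measurable
    have m1: "17 / 16 + 1 / 16 \<le> m (1 / N) k" and m2: "e * m (2 / N) k \<le> 1 / 64" for k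
    proof -
      have "1 / 8 \<le> (1 / N)\<^sup>2 * measure lborel (A k) / 2"
        using Am(1)[of k] N1 by (simp add: field_simps power2_eq_square)
      then show "17 / 16 + 1 / 16 \<le> m (1 / N) k"
        using exp_ge_add_one_self[of "(1 / N)\<^sup>2 * measure lborel (A k) / 2"] unfolding m_def by linarith
      have "(2 / N)\<^sup>2 * measure lborel (A k) / 2 \<le> 16"
        using Am(2)[of k] N1 by (simp add: field_simps power2_eq_square)
      then have "m (2 / N) k \<le> exp 16"
        by (simp add: m_def)
      then have "e * m (2 / N) k \<le> e * exp 16"
        using e by (intro mult_left_mono) auto
      also have "\<dots> = 1 / 64"
        by (simp add: e_def exp_minus)
      finally show "e * m (2 / N) k \<le> 1 / 64" .
    qed
    have dev: "prob {\<omega> \<in> space M. d \<le> \<bar>X \<mu> \<omega>\<bar>} \<le> real K * exp (2 * \<mu>\<^sup>2 * (8 * N\<^sup>2)) / d\<^sup>2" if "0 < d" for \<mu> d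
      using noise_exp_sum_deviation[of "{..<K}" A "8 * N\<^sup>2" d \<mu>] An disj Am(2) that
      unfolding X_def m_def by simp
    have p1: "prob {\<omega> \<in> space M. real K / 64 \<le> \<bar>X (1 / N) \<omega>\<bar>} \<le> 4096 * exp 16 / real K"
      using dev[of "real K / 64" "1 / N"] K N1 by (simp add: field_simps power2_eq_square)
    have "exp (64 :: real) * (exp (- 16) * exp (- 16)) = exp 32"
      by (simp add: exp_add[symmetric])
    then have p2: "prob {\<omega> \<in> space M. real K / (64 * e) \<le> \<bar>X (2 / N) \<omega>\<bar>} \<le> exp 32 / real K"
      using dev[of "real K / (64 * e)" "2 / N"] K N1 e by (simp add: field_simps power2_eq_square e_def)
    have ae: "AE \<omega> in M. \<forall>k<K. \<omega> \<in> global_event \<longrightarrow> \<sigma> / 2 * W (A k) \<omega> \<le> v (t, x + 4 * N * real k) \<omega>"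
    proof -
      have "AE \<omega> in M. \<omega> \<in> global_event \<longrightarrow> \<sigma> / 2 * W (A k) \<omega> \<le> v (t, x + 4 * N * real k) \<omega>" for k
        using solution_lower_bound[of t "x + 4 * N * real k"] N1 t
        unfolding A_def by (auto elim!: eventually_mono)
      then show ?thesis by (simp add: AE_all_countable)
    qed
    have "AE \<omega> in M. \<omega> \<in> {\<omega> \<in> global_event. (\<Sum>k<K. b (v (t, x + 4 * N * real k) \<omega>)) < c * real K} \<longrightarrow>
        \<omega> \<in> {\<omega> \<in> space M. real K / 64 \<le> \<bar>X (1 / N) \<omega>\<bar>} \<union> {\<omega> \<in> space M. real K / (64 * e) \<le> \<bar>X (2 / N) \<omega>\<bar>}"
      using ae
    proof eventually_elim
      case (elim \<omega>)
      show ?case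
      proof (intro impI, rule ccontr)
        assume \<omega>: "\<omega> \<in> {\<omega> \<in> global_event. (\<Sum>k<K. b (v (t, x + 4 * N * real k) \<omega>)) < c * real K}"
          and neg: "\<omega> \<notin> {\<omega> \<in> space M. real K / 64 \<le> \<bar>X (1 / N) \<omega>\<bar>} \<union> {\<omega> \<in> space M. real K / (64 * e) \<le> \<bar>X (2 / N) \<omega>\<bar>}"
        have "\<omega> \<in> space M" using \<omega> by (simp add: global_event_def)
        then have X1: "\<bar>X (1 / N) \<omega>\<bar> < real K / 64" and "\<bar>X (2 / N) \<omega>\<bar> < real K / (64 * e)"
          using neg by auto
        then have X2: "e * X (2 / N) \<omega> < real K / 64"
          using e by (simp add: field_simps abs_less_iff)
        define x1 where "x1 k = exp (1 / N * W (A k) \<omega>)" for k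
        have x2: "exp (2 / N * W (A k) \<omega>) = (x1 k)\<^sup>2" for k
          by (simp add: x1_def power2_eq_square exp_add[symmetric])
        have key: "4 * e * b z0 * (x1 k - 17 / 16 - e * (x1 k)\<^sup>2) \<le> b (v (t, x + 4 * N * real k) \<omega>)"
          if "k < K" for k
        proof (cases "N * a \<le> W (A k) \<omega>")
          case True
          have "4 * e * (x1 k - 17 / 16 - e * (x1 k)\<^sup>2) \<le> 1"
          proof -
            have "0 \<le> (2 * e * x1 k - 1)\<^sup>2" by simp
            then show ?thesis
              using e by (simp add: power2_eq_square algebra_simps)
          qed
          then have "4 * e * b z0 * (x1 k - 17 / 16 - e * (x1 k)\<^sup>2) \<le> b z0"
            using mult_left_mono[of "4 * e * (x1 k - 17 / 16 - e * (x1 k)\<^sup>2)" 1 "b z0"] z0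
            by (simp add: ac_simps)
          moreover have "z0 \<le> \<sigma> / 2 * (N * a)"
            using Nz \<sigma>_pos a by (simp add: field_simps)
          moreover have "\<sigma> / 2 * (N * a) \<le> \<sigma> / 2 * W (A k) \<omega>"
            using True \<sigma>_pos by (intro mult_left_mono) auto
          moreover have "\<sigma> / 2 * W (A k) \<omega> \<le> v (t, x + 4 * N * real k) \<omega>"
            using elim \<omega> that by simp
          ultimately show ?thesis
            using monoD[OF b_mono, of z0 "v (t, x + 4 * N * real k) \<omega>"] by linarith
        next
          case False
          then have "x1 k \<le> exp a"
            using N1 by (simp add: x1_def field_simps)
          then have "x1 k - 17 / 16 - e * (x1 k)\<^sup>2 \<le> 0"
            using a(2) mult_nonneg_nonneg[of e "(x1 k)\<^sup>2"] e zero_le_power2[of "x1 k"] by linarith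
          then have "4 * e * b z0 * (x1 k - 17 / 16 - e * (x1 k)\<^sup>2) \<le> 0"
            using e z0 by (simp add: mult_nonneg_nonpos)
          then show ?thesis
            using b_nonneg order_trans by blast
        qed
        have "(\<Sum>k<K. x1 k - 17 / 16 - e * (x1 k)\<^sup>2) =
            X (1 / N) \<omega> - e * X (2 / N) \<omega> + (\<Sum>k<K. m (1 / N) k - 17 / 16 - e * m (2 / N) k)"
          unfolding X_def x2 x1_def[symmetric]
          by (simp add: sum_subtractf sum.distrib sum_distrib_left algebra_simps)
        \<comment> \<open>The mean per column is 1/16 - 1/64 = 3/64. Each of the two fluctuations
          may take 1/64 of it, and 1/64 remains, which is the source of \<open>c\<close>.\<close>
        moreover have "(\<Sum>k<K. m (1 / N) k - 17 / 16 - e * m (2 / N) k) \<ge> (\<Sum>k<K. 3 / 64)"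
        proof (intro sum_mono)
          fix k
          show "3 / 64 \<le> m (1 / N) k - 17 / 16 - e * m (2 / N) k"
            using m1[of k] m2[of k] by linarith
        qed
        ultimately have "real K / 64 \<le> (\<Sum>k<K. x1 k - 17 / 16 - e * (x1 k)\<^sup>2)"
          using X1 X2 by (simp add: abs_less_iff)
        then have "4 * e * b z0 * (real K / 64) \<le> 4 * e * b z0 * (\<Sum>k<K. x1 k - 17 / 16 - e * (x1 k)\<^sup>2)"
          using e z0 by (intro mult_left_mono) auto
        also have "\<dots> = (\<Sum>k<K. 4 * e * b z0 * (x1 k - 17 / 16 - e * (x1 k)\<^sup>2))"
          by (rule sum_distrib_left)
        also have "\<dots> \<le> (\<Sum>k<K. b (v (t, x + 4 * N * real k) \<omega>))"
          using key by (intro sum_mono) auto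
        finally have "4 * e * b z0 * (real K / 64) \<le> (\<Sum>k<K. b (v (t, x + 4 * N * real k) \<omega>))" .
        moreover have "c * real K = 4 * e * b z0 * (real K / 64)"
          by (simp add: c_def)
        moreover have "(\<Sum>k<K. b (v (t, x + 4 * N * real k) \<omega>)) < c * real K"
          using \<omega> by simp
        ultimately show False
          by linarith
      qed
    qed
    then have "prob {\<omega> \<in> global_event. (\<Sum>k<K. b (v (t, x + 4 * N * real k) \<omega>)) < c * real K} \<le>
      prob ({\<omega> \<in> space M. real K / 64 \<le> \<bar>X (1 / N) \<omega>\<bar>} \<union> {\<omega> \<in> space M. real K / (64 * e) \<le> \<bar>X (2 / N) \<omega>\<bar>})"
      by (intro finite_measure_mono_AE) auto
    also have "\<dots> \<le> prob {\<omega> \<in> space M. real K / 64 \<le> \<bar>X (1 / N) \<omega>\<bar>} + prob {\<omega> \<in> space M. real K / (64 * e) \<le> \<bar>X (2 / N) \<omega>\<bar>}"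
      by (rule measure_Un_le) auto
    also have "\<dots> \<le> C / real K"
      using p1 p2 by (simp add: C_def add_divide_distrib)
    finally show ?thesis .
  qed
  moreover have "0 < c" "0 < C" "0 < N0"
    using e z0 by (auto simp: c_def C_def N0_def add_pos_pos)
  ultimately show ?thesis
    using that by blast
qed

section \<open>From columns of points to the mass of a strip\<close>

lemma measurable_v_shift [measurable]:
  "(\<lambda>(q, \<omega>). v (q + p) \<omega>) \<in> borel_measurable (lborel \<Otimes>\<^sub>M M)"
proof -
  have "(\<lambda>(q, \<omega>). (q + p, \<omega>)) \<in> measurable (lborel \<Otimes>\<^sub>M M) (lborel \<Otimes>\<^sub>M M)"
    by measurable
  from measurable_compose[OF this measurable_v] show ?thesis
    by (simp add: case_prod_beta')
qed

lemma S_shift: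
  assumes [measurable]: "Q \<in> sets borel" and \<omega>: "\<omega> \<in> space M"
  shows "(\<integral>\<^sup>+q\<in>Q. ennreal (b (v (q + p) \<omega>)) \<partial>lborel) = (\<integral>\<^sup>+q. ennreal (b (v q \<omega>)) * indicator Q (q - p) \<partial>lborel)"
proof -
  have [measurable]: "(\<lambda>q. v q \<omega>) \<in> borel_measurable lborel"
    using measurable_compose[OF measurable_Pair2' measurable_v, of \<omega>] \<omega> by simp
  have "(\<integral>\<^sup>+q. ennreal (b (v q \<omega>)) * indicator Q (q - p) \<partial>lborel) =
      (\<integral>\<^sup>+q. ennreal (b (v q \<omega>)) * indicator Q (q - p) \<partial>distr lborel borel ((+) p))"
    by (subst lborel_distr_plus) simp
  also have "\<dots> = (\<integral>\<^sup>+q\<in>Q. ennreal (b (v (q + p) \<omega>)) \<partial>lborel)"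
    by (subst nn_integral_distr) (simp_all add: add.commute)
  finally show ?thesis ..
qed

text \<open>The column estimate is averaged over base points in a square of side N. The K translates
  of this square by multiples of 4 N are disjoint and lie in the strip, so the integrated column sum
  is at most the mass of the strip. Passing from points to the square halves the mass constant and
  doubles the probability constant.\<close>

lemma drift_mass_start:
  assumes z0: "0 < b z0"
  obtains c C N0 :: real where "0 < c" "0 < C" "0 < N0"
    "\<And>N K. N0 \<le> N \<Longrightarrow> 0 < K \<Longrightarrow>
      prob {\<omega> \<in> global_event. S ({N..2 * N} \<times> {0..4 * N * real K}) \<omega> < ennreal (c * real K * N\<^sup>2)} \<le> C / real K"
proof -
  obtain c C N0 :: real where c: "0 < c" "0 < C" "0 < N0" and
    col: "\<And>N K t x. N0 \<le> N \<Longrightarrow> 0 < K \<Longrightarrow> N \<le> t \<Longrightarrow> t \<le> 2 * N \<Longrightarrow>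
      prob {\<omega> \<in> global_event. (\<Sum>k<K. b (v (t, x + 4 * N * real k) \<omega>)) < c * real K} \<le> C / real K"
    using drift_column_sum[OF z0] by blast
  have "prob {\<omega> \<in> global_event. S ({N..2 * N} \<times> {0..4 * N * real K}) \<omega> < ennreal (c / 2 * real K * N\<^sup>2)} \<le> 2 * C / real K"
    if N: "N0 \<le> N" and K: "0 < K" for N :: real and K :: nat
  proof -
    have N1: "0 < N" using N c by simp
    let ?Q = "{N..2 * N} \<times> {0..N}" and ?R = "{N..2 * N} \<times> {0..4 * N * real K}"
    define p where "p k = (0 :: real, 4 * N * real k)" for k
    define A where "A k = {N..2 * N} \<times> {4 * N * real k..4 * N * real k + N}" for k
    have disj: "A i \<inter> A j = {}" if "i \<noteq> j" for i j
    proof -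
      have "1 \<le> \<bar>real i - real j\<bar>" using that by linarith
      then have "4 * N * 1 \<le> 4 * N * \<bar>real i - real j\<bar>"
        using N1 by (intro mult_left_mono) auto
      also have "\<dots> = \<bar>4 * N * real i - 4 * N * real j\<bar>"
        using N1 by (simp add: abs_mult right_diff_distrib[symmetric])
      finally show ?thesis
        using N1 by (auto simp: A_def)
    qed
    have AR: "A k \<subseteq> ?R" if "k < K" for k
    proof -
      have "4 * N * (real k + 1) \<le> 4 * N * real K"
        using that N1 by (intro mult_left_mono) auto
      moreover have "0 \<le> 4 * N * real k" using N1 by simp
      ultimately have "{4 * N * real k..4 * N * real k + N} \<subseteq> {0..4 * N * real K}"
        using N1 by (auto simp: distrib_left)
      then show ?thesis unfolding A_def by (rule Sigma_mono[OF order_refl])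
    qed
    define g where "g q \<omega> = (\<Sum>k<K. ennreal (b (v (q + p k) \<omega>)))" for q \<omega>
    have [measurable]: "(\<lambda>(q, \<omega>). g q \<omega>) \<in> borel_measurable (lborel \<Otimes>\<^sub>M M)"
      unfolding g_def by measurable
    have Q: "emeasure lborel ?Q = ennreal (N\<^sup>2)" "0 < N\<^sup>2"
      using N1 by (auto simp: emeasure_lborel_rectangle power2_eq_square)
    have "prob {\<omega> \<in> global_event. g q \<omega> < ennreal (c * real K)} \<le> C / real K" if q: "q \<in> ?Q" for q
    proof -
      obtain t x where tx: "q = (t, x)" "N \<le> t" "t \<le> 2 * N" using q by auto
      have "g q \<omega> < ennreal (c * real K) \<longleftrightarrow> (\<Sum>k<K. b (v (t, x + 4 * N * real k) \<omega>)) < c * real K" for \<omega>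
        unfolding g_def tx p_def
        by (subst sum_ennreal) (auto simp: b_nonneg sum_nonneg ennreal_less_iff)
      then show ?thesis
        using col[OF N K tx(2,3), of x] by simp
    qed
    then have "prob {\<omega> \<in> global_event. (\<integral>\<^sup>+q\<in>?Q. g q \<omega> \<partial>lborel) < ennreal (c * real K * N\<^sup>2 / 2)} \<le> 2 * (C / real K)"
      using c K by (intro prob_integral_small_le Q) auto
    moreover have "prob {\<omega> \<in> global_event. S ?R \<omega> < ennreal (c / 2 * real K * N\<^sup>2)} \<le>
        prob {\<omega> \<in> global_event. (\<integral>\<^sup>+q\<in>?Q. g q \<omega> \<partial>lborel) < ennreal (c * real K * N\<^sup>2 / 2)}"
    proof (rule finite_measure_mono)
      have "{\<omega> \<in> global_event. (\<integral>\<^sup>+q\<in>?Q. g q \<omega> \<partial>lborel) < ennreal (c * real K * N\<^sup>2 / 2)} =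
        {\<omega> \<in> space M. \<omega> \<in> global_event \<and> (\<integral>\<^sup>+q\<in>?Q. g q \<omega> \<partial>lborel) < ennreal (c * real K * N\<^sup>2 / 2)}"
        by (auto simp: global_event_def)
      also have "\<dots> \<in> events" by measurable
      finally show "{\<omega> \<in> global_event. (\<integral>\<^sup>+q\<in>?Q. g q \<omega> \<partial>lborel) < ennreal (c * real K * N\<^sup>2 / 2)} \<in> events" .
      have "(\<integral>\<^sup>+q\<in>?Q. g q \<omega> \<partial>lborel) \<le> S ?R \<omega>" if \<omega>: "\<omega> \<in> global_event" for \<omega>
      proof -
        have sp: "\<omega> \<in> space M" using \<omega> by (simp add: global_event_def)
        then have [measurable]: "(\<lambda>q. v q \<omega>) \<in> borel_measurable lborel"
          using measurable_compose[OF measurable_Pair2' measurable_v, of \<omega>] by simp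
        have "(\<integral>\<^sup>+q\<in>?Q. g q \<omega> \<partial>lborel) = (\<Sum>k<K. \<integral>\<^sup>+q\<in>?Q. ennreal (b (v (q + p k) \<omega>)) \<partial>lborel)"
          unfolding g_def sum_distrib_right by (subst nn_integral_sum) auto
        also have "\<dots> = (\<Sum>k<K. \<integral>\<^sup>+q. ennreal (b (v q \<omega>)) * indicator ?Q (q - p k) \<partial>lborel)"
          by (simp add: S_shift[OF sets_rectangle sp])
        also have "\<dots> = (\<integral>\<^sup>+q. (\<Sum>k<K. ennreal (b (v q \<omega>)) * indicator ?Q (q - p k)) \<partial>lborel)"
          by (subst nn_integral_sum) auto
        also have "\<dots> \<le> S ?R \<omega>"
          unfolding S_def
        proof (rule nn_integral_mono)
          fix q :: "real \<times> real"
          have "(\<Sum>k<K. indicator ?Q (q - p k)) \<le> (indicator ?R q :: ennreal)"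
          proof -
            have "(\<Sum>k<K. indicator ?Q (q - p k)) = (\<Sum>k<K. indicator (A k) q :: ennreal)"
              by (intro sum.cong refl) (cases q; simp add: A_def p_def indicator_def algebra_simps)
            also have "\<dots> = indicator (\<Union>k\<in>{..<K}. A k) q"
              using disj by (intro indicator_UN_disjoint[symmetric]) (auto simp: disjoint_family_on_def)
            also have "\<dots> \<le> indicator ?R q"
              using AR by (intro indicator_leI) blast
            finally show ?thesis .
          qed
          then show "(\<Sum>k<K. ennreal (b (v q \<omega>)) * indicator ?Q (q - p k)) \<le> ennreal (b (v q \<omega>)) * indicator ?R q"
            unfolding sum_distrib_left[symmetric] by (intro mult_left_mono) auto
        qed
        finally show ?thesis .
      qed
      then show "{\<omega> \<in> global_event. S ?R \<omega> < ennreal (c / 2 * real K * N\<^sup>2)} \<subseteq>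
        {\<omega> \<in> global_event. (\<integral>\<^sup>+q\<in>?Q. g q \<omega> \<partial>lborel) < ennreal (c * real K * N\<^sup>2 / 2)}"
        by (intro Collect_mono impI conjI; elim conjE; auto intro: le_less_trans)
    qed
    ultimately show ?thesis by simp
  qed
  then show ?thesis
    using that[of "c / 2" "2 * C" N0] c by simp
qed

end

section \<open>The cascade\<close>

lemma rectangle_subset_light_cone:
  assumes "0 < p" "q + c + \<bar>x\<bar> < t" "- c \<le> l" "r \<le> c"
  shows "{p..q} \<times> {l..r} \<subseteq> light_cone t x"
proof
  fix z assume "z \<in> {p..q} \<times> {l..r}"
  then obtain s y where z: "z = (s, y)" "p \<le> s" "s \<le> q" "l \<le> y" "y \<le> r" by auto
  have "\<bar>y\<bar> \<le> c" using z assms by linarith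
  then have "\<bar>x - y\<bar> < t - s" "s < t" using z(3) assms(2) by linarith+
  then show "z \<in> light_cone t x"
    unfolding z(1) mem_light_cone using z(2) assms(1) by simp
qed

context wave_solution
begin

text \<open>If the start and all steps succeed, the masses \<open>Y k\<close> all fit into one cone,
  whose drift mass is finite on the global event. Hence that event is almost surely covered by the
  failures, and a union bound suffices whatever their dependence.\<close>

lemma global_event_cascade:
  fixes Y :: "nat \<Rightarrow> real"
  assumes Q: "\<And>k. Q k \<in> sets borel"
    and start: "prob {\<omega> \<in> global_event. S (Q 0) \<omega> < ennreal (Y 0)} \<le> e0"
    and step: "\<And>k. prob {\<omega> \<in> global_event. ennreal (Y k) \<le> S (Q k) \<omega> \<and> S (Q (Suc k)) \<omega> < ennreal (Y (Suc k))} \<le> e k"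
    and e: "summable e"
    and t: "0 < t" and sub: "\<And>k. Q k \<subseteq> light_cone t x" and unbounded: "\<And>y. \<exists>k. y < Y k"
  shows "prob global_event \<le> e0 + suminf e"
proof -
  note [measurable] = Q
  let ?A = "{\<omega> \<in> space M. \<omega> \<in> global_event \<and> S (Q 0) \<omega> < ennreal (Y 0)}"
  let ?B = "\<lambda>k. {\<omega> \<in> space M. \<omega> \<in> global_event \<and> ennreal (Y k) \<le> S (Q k) \<omega> \<and> S (Q (Suc k)) \<omega> < ennreal (Y (Suc k))}"
  have A: "?A = {\<omega> \<in> global_event. S (Q 0) \<omega> < ennreal (Y 0)}"
    and B: "?B k = {\<omega> \<in> global_event. ennreal (Y k) \<le> S (Q k) \<omega> \<and> S (Q (Suc k)) \<omega> < ennreal (Y (Suc k))}" for k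
    by (auto simp: global_event_def)
  have "AE \<omega> in M. \<omega> \<in> global_event \<longrightarrow> \<omega> \<in> ?A \<union> (\<Union>k. ?B k)"
    using solution_lower_bound[OF t, of x]
  proof eventually_elim
    case (elim \<omega>)
    show ?case
    proof (intro impI, rule ccontr)
      assume \<omega>: "\<omega> \<in> global_event" and "\<omega> \<notin> ?A \<union> (\<Union>k. ?B k)"
      then have 0: "ennreal (Y 0) \<le> S (Q 0) \<omega>"
        and 1: "ennreal (Y k) \<le> S (Q k) \<omega> \<Longrightarrow> ennreal (Y (Suc k)) \<le> S (Q (Suc k)) \<omega>" for k
        using not_le by (auto simp: global_event_def)
      obtain I where I: "S (light_cone t x) \<omega> = ennreal I" "0 \<le> I"
        using elim \<omega> by blast
      obtain k where k: "I < Y k"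
        using unbounded by blast
      have "ennreal (Y k) \<le> S (Q k) \<omega>"
        using 0 1 by (induction k) auto
      also have "\<dots> \<le> ennreal I"
        using S_mono[OF sub] I(1) by metis
      finally show False
        using k I(2) by simp
    qed
  qed
  then have "prob global_event \<le> prob (?A \<union> (\<Union>k. ?B k))"
    by (intro finite_measure_mono_AE) auto
  also have "\<dots> \<le> prob ?A + prob (\<Union>k. ?B k)"
    by (rule measure_Un_le) auto
  also have "prob (\<Union>k. ?B k) \<le> suminf e"
  proof -
    have le: "prob (?B k) \<le> e k" for k
      unfolding B by (rule step)
    have summ: "summable (\<lambda>k. prob (?B k))"
      using le by (intro summable_comparison_test[OF _ e]) auto
    have "prob (\<Union>k. ?B k) \<le> (\<Sum>k. prob (?B k))"
      by (rule finite_measure_subadditive_countably[OF _ summ]) auto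
    also have "\<dots> \<le> suminf e"
      by (rule suminf_le[OF le summ e])
    finally show ?thesis .
  qed
  finally show ?thesis
    using start unfolding A by linarith
qed

text \<open>
  The side \<open>sqrt (8 L / b L)\<close> is chosen such that a solution above \<open>L\<close> on half of the square collects
  the drift mass \<open>8 L\<close> there; this pays for the next level \<open>2 L\<close> and a noise of size \<open>L\<close>.
\<close>

lemma drift_square_step:
  defines "r \<equiv> \<lambda>L. sqrt (8 * L / b L)"
  assumes L: "0 < L" "0 < b L" and Q: "Q \<in> sets borel"
    and sub: "\<And>t x. T \<le> t \<Longrightarrow> t \<le> T + r L \<Longrightarrow> \<bar>x\<bar> \<le> r L \<Longrightarrow> Q \<subseteq> light_cone t x"
    and T: "0 < T" "T + r L \<le> T'" and Y: "0 \<le> Y" and G: "0 < G" and LY: "L \<le> Y / 2 - G"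
  shows "prob {\<omega> \<in> global_event. ennreal Y \<le> S Q \<omega> \<and> S ({T..T + r L} \<times> {- r L..r L}) \<omega> < ennreal (8 * L)}
    \<le> \<sigma>\<^sup>2 * T'\<^sup>2 / G\<^sup>2"
proof -
  have r: "0 < r L" "(r L)\<^sup>2 = 8 * L / b L"
    using L by (auto simp: r_def)
  let ?Q' = "{T..T + r L} \<times> {- r L..r L}"
  have A: "emeasure lborel ?Q' = ennreal (16 * L / b L)"
  proof -
    have "emeasure lborel ?Q' = ennreal ((T + r L - T) * (r L - - r L))"
      using r by (intro emeasure_lborel_rectangle) auto
    also have "(T + r L - T) * (r L - - r L) = 2 * (r L)\<^sup>2"
      by (simp add: power2_eq_square)
    finally show ?thesis by (simp add: r(2))
  qed
  have "8 * L = b L * (16 * L / b L) / 2"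
    using L by simp
  also have "\<dots> \<le> b (Y / 2 - G) * (16 * L / b L) / 2"
    using L monoD[OF b_mono LY] by (intro divide_right_mono mult_right_mono) auto
  finally have le: "ennreal (8 * L) \<le> ennreal (b (Y / 2 - G) * (16 * L / b L) / 2)"
    by (rule ennreal_leI)
  have [measurable]: "Q \<in> sets borel" by fact
  have "prob {\<omega> \<in> global_event. ennreal Y \<le> S Q \<omega> \<and> S ?Q' \<omega> < ennreal (8 * L)} \<le>
    prob {\<omega> \<in> space M. \<omega> \<in> global_event \<and> ennreal Y \<le> S Q \<omega> \<and> S ?Q' \<omega> < ennreal (b (Y / 2 - G) * (16 * L / b L) / 2)}"
  proof (rule finite_measure_mono)
    show "{\<omega> \<in> global_event. ennreal Y \<le> S Q \<omega> \<and> S ?Q' \<omega> < ennreal (8 * L)} \<subseteq>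
      {\<omega> \<in> space M. \<omega> \<in> global_event \<and> ennreal Y \<le> S Q \<omega> \<and> S ?Q' \<omega> < ennreal (b (Y / 2 - G) * (16 * L / b L) / 2)}"
      using less_le_trans[OF _ le] by (auto simp: global_event_def)
  qed measurable
  also have "\<dots> = prob {\<omega> \<in> global_event. ennreal Y \<le> S Q \<omega> \<and> S ?Q' \<omega> < ennreal (b (Y / 2 - G) * (16 * L / b L) / 2)}"
    by (rule arg_cong[where f=prob]) (auto simp: global_event_def)
  also have "\<dots> \<le> \<sigma>\<^sup>2 * T'\<^sup>2 / G\<^sup>2"
  proof (rule drift_mass_step[OF Q sets_rectangle A _ _ Y G])
    show "0 < 16 * L / b L" using L by simp
    fix t x assume "(t, x) \<in> ?Q'"
    then have "T \<le> t" "t \<le> T + r L" "\<bar>x\<bar> \<le> r L" by auto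
    then show "0 < t \<and> t \<le> T' \<and> Q \<subseteq> light_cone t x"
      using sub T by auto
  qed
  finally show ?thesis .
qed

text \<open>The choice of scales. With N = K = 4^i the start fails with probability at most C/N. The
  cascade runs at times of order N^2 from a level of order N^(5/2), so Chebyshev gives N^4/N^5 = 1/N
  for its first steps and a geometric decay afterwards. \<open>D\<close> does not depend on
  i.\<close>

lemma prob_global_event_le:
  assumes summ: "summable (\<lambda>k. sqrt (2 ^ k / b (2 ^ k)))" and pos: "0 < b (2 ^ k0)"
  obtains D i0 where "\<And>i. i0 \<le> i \<Longrightarrow> prob global_event \<le> D / 4 ^ i"
proof -
  define r where "r L = sqrt (8 * L / b L)" for L
  define h where "h j = r (2 ^ j)" for j :: nat
  have h_nonneg: "0 \<le> h j" for j
    by (simp add: h_def r_def b_nonneg)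
  have "summable (\<lambda>j. sqrt 8 * sqrt (2 ^ j / b (2 ^ j)))"
    by (rule summable_mult[OF summ])
  then have summable_h: "summable h"
    by (simp add: h_def[abs_def] r_def real_sqrt_mult[symmetric])
  define H where "H = suminf h"
  have sum_h: "(\<Sum>j<k. h (m + j)) \<le> H" for k m
  proof -
    have "(\<Sum>j<k. h (m + j)) = sum h ((+) m ` {..<k})"
      by (subst sum.reindex) auto
    also have "\<dots> \<le> H"
      unfolding H_def using h_nonneg by (intro sum_le_suminf summable_h) auto
    finally show ?thesis .
  qed
  have h_le: "h m \<le> H" for m
  proof -
    have "(\<Sum>j<1. h (m + j)) \<le> H" by (rule sum_h)
    then show ?thesis by simp
  qed
  have H: "0 \<le> H"
    using h_nonneg[of 0] h_le[of 0] by linarith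
  obtain c C N0 :: real where c: "0 < c" "0 < C" "0 < N0" and
    start: "\<And>N K. N0 \<le> N \<Longrightarrow> 0 < K \<Longrightarrow>
      prob {\<omega> \<in> global_event. S ({N..2 * N} \<times> {0..4 * N * real K}) \<omega> < ennreal (c * real K * N\<^sup>2)} \<le> C / real K"
    using drift_mass_start[OF pos] by blast
  \<comment> \<open>With \<open>k0\<close>, these fix how large i must be: \<open>k0\<close> makes
    \<open>b\<close> positive at every level, \<open>n1\<close> gives \<open>N0 \<le> N\<close>, and
    \<open>n2\<close> gives \<open>8 \<le> c * 2 ^ i\<close>, so that the starting mass is at least
    \<open>4 * L 0\<close>.\<close>
  obtain n1 n2 where n1: "N0 < 4 ^ n1" and n2: "8 / c < 2 ^ n2"
    using real_arch_pow[of 4 N0] real_arch_pow[of 2 "8 / c"] by auto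
  \<comment> \<open>The time bound \<open>T'\<close> is at most (7 + 8 H) N^2, where 7 = 4 + 2 + 1
    comes from \<open>B\<close>. The factor 4/3 is what remains of the geometric sum 16/3 after
    division by the 4 in \<open>(L 0)\<^sup>2\<close>.\<close>
  define D where "D = C + 4 / 3 * \<sigma>\<^sup>2 * (7 + 8 * H)\<^sup>2"
  have "prob global_event \<le> D / 4 ^ i" if i: "k0 + n1 + n2 \<le> i" for i
  proof -
    define N where "N = (4 :: real) ^ i"
    have N1: "1 \<le> N" by (simp add: N_def)
    have "(4 :: real) ^ n1 \<le> N"
      unfolding N_def using i by (intro power_increasing) auto
    then have N0: "N0 \<le> N" using n1 by simp
    have "(2 :: real) ^ n2 \<le> 2 ^ i"
      using i by (intro power_increasing) auto
    then have "8 / c \<le> 2 ^ i" using n2 by linarith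
    then have ci: "8 \<le> c * 2 ^ i" using c by (simp add: field_simps)
    \<comment> \<open>The first level is 2 N^(5/2). Taking N as a power of 4 makes it a power of
      two, namely 2 x^5 with x = 2^i.\<close>
    define L where "L k = (2 :: real) ^ (5 * i + 1 + k)" for k
    define x where "x = (2 :: real) ^ i"
    have x: "0 < x" "(4 :: real) ^ i = x\<^sup>2" "N = x\<^sup>2" "L 0 = 2 * x ^ 5"
    proof -
      show "0 < x" by (simp add: x_def)
      show "(4 :: real) ^ i = x\<^sup>2"
        by (simp add: x_def power2_eq_square power_mult_distrib[symmetric])
      then show "N = x\<^sup>2" by (simp add: N_def)
      have "x ^ 5 = 2 ^ (i * 5)"
        unfolding x_def by (rule power_mult[symmetric])
      then show "L 0 = 2 * x ^ 5"
        by (simp add: L_def mult.commute)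
    qed
    define g where "g k = h (5 * i + 1 + k)" for k
    have g: "g k = r (L k)" "0 \<le> g k" "g k \<le> H" for k
      by (simp_all only: g_def h_nonneg h_le) (simp only: h_def L_def)
    have L: "0 < L k" "L (Suc k) = 2 * L k" "0 < b (L k)" for k
    proof -
      show "0 < L k" "L (Suc k) = 2 * L k" by (simp_all add: L_def)
      have "(2 :: real) ^ k0 \<le> L k"
        unfolding L_def using i by (intro power_increasing) auto
      then show "0 < b (L k)"
        using pos monoD[OF b_mono, of "2 ^ k0" "L k"] by linarith
    qed
    have g_pos: "0 < g k" for k
      using L(1,3)[of k] by (simp add: g(1) r_def)
    \<comment> \<open>To see the starting strip a point needs a time above 2 N + 4 N^2 plus its
      distance from the axis; the 1 makes the inequality strict, and \<open>g 0\<close> in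
      \<open>T\<close> pays for the distance.\<close>
    define B where "B = 4 * N\<^sup>2 + 2 * N + 1"
    \<comment> \<open>A square of duration and half-width \<open>g n\<close> must be seen from the
      whole next one, at distance up to \<open>g (Suc n)\<close> from the axis. This takes twice
      \<open>g n\<close> plus once \<open>g (Suc n)\<close>; three of each leaves slack. In total
      the stacking costs at most 8 H.\<close>
    define T where "T k = B + g 0 + 3 * (\<Sum>j<k. g j + g (Suc j))" for k
    define T' where "T' = B + 8 * H"
    have B: "0 < B" using N1 by (simp add: B_def add_pos_pos)
    have T: "0 < T k" "T k + g k \<le> T'" for k
    proof -
      have "0 \<le> (\<Sum>j<k. g j + g (Suc j))"
        using g(2) by (intro sum_nonneg add_nonneg_nonneg)
      then show "0 < T k" using B g(2)[of 0] by (simp add: T_def add_pos_nonneg)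
      have "(\<Sum>j<k. h (5 * i + 1 + j)) \<le> H" "(\<Sum>j<k. h (5 * i + 2 + j)) \<le> H"
        by (rule sum_h)+
      then have "(\<Sum>j<k. g j) \<le> H" "(\<Sum>j<k. g (Suc j)) \<le> H"
        by (simp_all add: g_def)
      then show "T k + g k \<le> T'"
        using g(3)[of 0] g(3)[of k] by (simp add: T_def T'_def sum.distrib)
    qed
    define K where "K = (4 :: nat) ^ i"
    have K: "0 < K" "real K = N" by (simp_all add: K_def N_def)
    have NN: "4 * N * real K = 4 * N\<^sup>2"
      unfolding K(2) by (simp add: power2_eq_square)
    define Q where "Q k = (case k of 0 \<Rightarrow> {N..2 * N} \<times> {0..4 * N * real K}
      | Suc k \<Rightarrow> {T k..T k + g k} \<times> {- g k..g k})" for k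
    have Q_0: "Q 0 = {N..2 * N} \<times> {0..4 * N\<^sup>2}"
      and Q_Suc: "Q (Suc n) = {T n..T n + g n} \<times> {- g n..g n}" for n
      unfolding Q_def NN by simp_all
    define Y where "Y k = (case k of 0 \<Rightarrow> c * real K * N\<^sup>2 | Suc k \<Rightarrow> 8 * L k)" for k
    have Y_Suc: "Y (Suc n) = 8 * L n" for n
      by (simp_all add: Y_def)
    define d where "d = \<sigma>\<^sup>2 * T'\<^sup>2 / (L 0)\<^sup>2"
    \<comment> \<open>Step n + 1 allows noise down to \<open>- L n\<close> and so fails with
      probability at most d / 4^n. The factor 4 is the shift of index; step 0, with allowance
      \<open>L 0\<close>, needs only d.\<close>
    define e where "e k = 4 * d * (1 / 4) ^ k" for k :: nat
    have d: "0 \<le> d" by (simp add: d_def)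
    have eL: "\<sigma>\<^sup>2 * T'\<^sup>2 / (L n)\<^sup>2 = e (Suc n)" for n
    proof -
      have "L n = L 0 * 2 ^ n"
        by (simp add: L_def power_add)
      then have "(L n)\<^sup>2 = (L 0)\<^sup>2 * 4 ^ n"
        by (simp add: power_mult_distrib power2_eq_square[of "2 ^ n"] power_mult_distrib[symmetric])
      then show ?thesis
        by (simp add: e_def d_def power_one_over)
    qed
    have N2: "N \<le> N\<^sup>2" "1 \<le> N\<^sup>2"
      using N1 by (simp_all add: power2_eq_square mult_ge1_I)
    have Qsets: "Q k \<in> sets borel" for k
      by (cases k) (auto simp: Q_def)
    have p0: "prob {\<omega> \<in> global_event. S (Q 0) \<omega> < ennreal (Y 0)} \<le> C / 4 ^ i"
    proof -
      have "Q 0 = {N..2 * N} \<times> {0..4 * N * real K}" "Y 0 = c * real K * N\<^sup>2"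
        by (simp_all only: Q_def Y_def nat.case)
      then show ?thesis
        using start[OF N0 K(1)] unfolding K(2) N_def by (simp only:)
    qed
    have step: "prob {\<omega> \<in> global_event. ennreal (Y k) \<le> S (Q k) \<omega> \<and> S (Q (Suc k)) \<omega> < ennreal (Y (Suc k))} \<le> e k" for k
    proof (cases k)
      case 0
      have "prob {\<omega> \<in> global_event. ennreal (Y 0) \<le> S (Q 0) \<omega> \<and>
          S ({T 0..T 0 + r (L 0)} \<times> {- r (L 0)..r (L 0)}) \<omega> < ennreal (8 * L 0)} \<le> \<sigma>\<^sup>2 * T'\<^sup>2 / (L 0)\<^sup>2"
      proof (rule drift_square_step[folded r_def, OF L(1,3) Qsets _ T(1) _ _ L(1)])
        show "T 0 + r (L 0) \<le> T'" using T(2)[of 0] g(1) by simp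
        show "0 \<le> Y 0" using c N1 by (simp add: Y_def K(2))
        have "8 * x ^ 5 \<le> c * x * x ^ 5"
          using ci x(1) unfolding x_def[symmetric] by (intro mult_right_mono) auto
        also have "\<dots> = Y 0"
          by (simp add: Y_def K(2) x power_mult[symmetric] power_add[symmetric] eval_nat_numeral)
        finally show "L 0 \<le> Y 0 / 2 - L 0"
          unfolding x(4) by simp
        fix t y assume t: "T 0 \<le> t" "t \<le> T 0 + r (L 0)" and y: "\<bar>y\<bar> \<le> r (L 0)"
        show "Q 0 \<subseteq> light_cone t y"
          unfolding Q_0
        proof (rule rectangle_subset_light_cone)
          have "T 0 = 4 * N\<^sup>2 + 2 * N + 1 + r (L 0)" by (simp add: T_def B_def g(1))
          then show "2 * N + 4 * N\<^sup>2 + \<bar>y\<bar> < t" using t y by linarith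
        qed (use N1 in auto)
      qed
      also have "\<dots> \<le> e 0" using d by (simp add: e_def d_def[symmetric])
      finally show ?thesis
        unfolding 0 Q_Suc Y_Suc g(1) .
    next
      case (Suc n)
      have "prob {\<omega> \<in> global_event. ennreal (Y k) \<le> S (Q k) \<omega> \<and>
          S ({T k..T k + r (L k)} \<times> {- r (L k)..r (L k)}) \<omega> < ennreal (8 * L k)} \<le> \<sigma>\<^sup>2 * T'\<^sup>2 / (L n)\<^sup>2"
      proof (rule drift_square_step[folded r_def, OF L(1,3) Qsets _ T(1) _ _ L(1)])
        show "T k + r (L k) \<le> T'" using T(2)[of k] g(1) by simp
        show "0 \<le> Y k" using L(1)[of n] by (simp add: Y_def Suc)
        \<comment> \<open>The drift contributes \<open>4 * L n\<close>, the noise takes at most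
          \<open>L n\<close>, and the next level asks for \<open>2 * L n\<close>.\<close>
        show "L k \<le> Y k / 2 - L n"
          using L(1)[of n] L(2)[of n] by (simp add: Y_def Suc)
        fix t y assume t: "T k \<le> t" "t \<le> T k + r (L k)" and y: "\<bar>y\<bar> \<le> r (L k)"
        have "T k = T n + 3 * g n + 3 * g k"
          by (simp add: T_def Suc)
        then have "T n + g n + g n + \<bar>y\<bar> < t"
          using t(1) y[folded g(1)] g_pos[of k] g(2)[of n] by linarith
        then show "Q k \<subseteq> light_cone t y"
          unfolding Suc Q_Suc using T(1)[of n]
          by (intro rectangle_subset_light_cone[where c="g n"]) simp_all
      qed
      also have "\<dots> = e k"
        using eL[of n] by (simp only: Suc)
      finally show ?thesis
        unfolding Q_Suc Y_Suc g(1) .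
    qed
    have e_sums: "e sums (4 * d * (4 / 3))"
    proof -
      have "(\<lambda>k. (1 / 4 :: real) ^ k) sums (4 / 3)"
        using geometric_sums[of "1 / 4 :: real"] by simp
      from sums_mult[OF this, of "4 * d"] show ?thesis
        unfolding e_def[abs_def] .
    qed
    have "prob global_event \<le> C / 4 ^ i + suminf e"
    proof (rule global_event_cascade[OF Qsets p0 step])
      show "summable e" using e_sums by (rule sums_summable)
      \<comment> \<open>All sets of the cascade lie at times up to \<open>T'\<close> and within
        distance \<open>T'\<close> of the axis, so a single apex on the axis sees them all.\<close>
      show "0 < 2 * T' + 1" using B H by (simp add: T'_def)
      show "Q k \<subseteq> light_cone (2 * T' + 1) 0" for k
      proof (cases k)
        case 0
        show ?thesis
          unfolding 0 Q_0 using N1 H N2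
          by (intro rectangle_subset_light_cone[where c="4 * N\<^sup>2"]) (auto simp: T'_def B_def)
      next
        case (Suc n)
        have "H \<le> T'" using B H by (simp add: T'_def)
        then show ?thesis
          unfolding Suc Q_Suc using T[of n] g(2,3)[of n]
          by (intro rectangle_subset_light_cone[where c="g n"]) simp_all
      qed
      show "\<exists>k. y < Y k" for y
      proof -
        obtain n where n: "y < 2 ^ n"
          using real_arch_pow[of 2 y] by auto
        have "(2 :: real) ^ n \<le> L n"
          unfolding L_def by (intro power_increasing) auto
        then have "y < Y (Suc n)"
          using n L(1)[of n] by (simp add: Y_def)
        then show ?thesis ..
      qed
    qed
    also have "suminf e = 4 * d * (4 / 3)"
      using e_sums by (rule sums_unique[symmetric])
    also have "C / 4 ^ i + \<dots> \<le> D / 4 ^ i"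
    proof -
      have "T' \<le> (7 + 8 * H) * N\<^sup>2"
      proof -
        have "H * 1 \<le> H * N\<^sup>2"
          using H N2 by (intro mult_left_mono)
        then show ?thesis
          using N2 by (simp add: T'_def B_def algebra_simps)
      qed
      then have "T'\<^sup>2 \<le> (7 + 8 * H)\<^sup>2 * (N\<^sup>2)\<^sup>2"
        using B H power_mono[of T' "(7 + 8 * H) * N\<^sup>2" 2] by (simp add: T'_def power_mult_distrib)
      then have "d \<le> \<sigma>\<^sup>2 * ((7 + 8 * H)\<^sup>2 * (N\<^sup>2)\<^sup>2) / (L 0)\<^sup>2"
        unfolding d_def by (intro divide_right_mono mult_left_mono) simp_all
      also have "(L 0)\<^sup>2 = 4 * 4 ^ i * (N\<^sup>2)\<^sup>2"
        by (simp add: x power_mult_distrib power_mult[symmetric] power_add[symmetric])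
      also have "\<sigma>\<^sup>2 * ((7 + 8 * H)\<^sup>2 * (N\<^sup>2)\<^sup>2) / (4 * 4 ^ i * (N\<^sup>2)\<^sup>2) = \<sigma>\<^sup>2 * (7 + 8 * H)\<^sup>2 / 4 / 4 ^ i"
        using N1 by simp
      finally have "16 / 3 * d \<le> 4 / 3 * \<sigma>\<^sup>2 * (7 + 8 * H)\<^sup>2 / 4 ^ i"
        by simp
      then show ?thesis
        by (simp add: D_def add_divide_distrib)
    qed
    finally show ?thesis .
  qed
  then show ?thesis
    using that by blast
qed

text \<open>The scale i is free and the event does not depend on it, so letting i tend to infinity
  makes the event null.\<close>

lemma no_global_solution:
  assumes summ: "summable (\<lambda>k. sqrt (2 ^ k / b (2 ^ k)))" and pos: "0 < b (2 ^ k0)"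
  shows "AE \<omega> in M. \<tau> \<omega> < \<infinity>"
proof -
  obtain D i0 where le: "\<And>i. i0 \<le> i \<Longrightarrow> prob global_event \<le> D / 4 ^ i"
    using prob_global_event_le[OF summ pos] by metis
  have "(\<lambda>i. D / 4 ^ i) \<longlonglongrightarrow> 0"
    by (rule LIMSEQ_divide_realpow_zero) simp
  moreover have "\<exists>i0. \<forall>i\<ge>i0. prob global_event \<le> D / 4 ^ i"
    using le by blast
  ultimately have "prob global_event \<le> 0"
    by (rule LIMSEQ_le_const)
  then have "global_event \<in> null_sets M"
    using measure_nonneg[of M global_event] sets_global_event
    by (intro null_setsI) (simp_all add: emeasure_eq_measure)
  then have "AE \<omega> in M. \<omega> \<notin> global_event"
    by (rule AE_not_in)
  with AE_space show ?thesis
  proof eventually_elim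
    case (elim \<omega>)
    then show ?case
      by (simp add: global_event_def less_top)
  qed
qed

end

theorem theorem1p5:
  fixes M :: "'a measure"
    and F :: "ennreal \<Rightarrow> 'a measure"
    and W :: "(real \<times> real) set \<Rightarrow> 'a \<Rightarrow> real"
    and b u0 v0 :: "real \<Rightarrow> real"
    and \<sigma> \<alpha> \<beta> :: real
    and \<tau> :: "'a \<Rightarrow> ennreal"
    and u :: "real \<Rightarrow> real \<Rightarrow> 'a \<Rightarrow> real"
  assumes "filtered_prob_space M F"
    and "white_noise M F W"
    and "local_lipschitz (UNIV :: real set) UNIV (\<lambda>_. b)"
    and "\<And>z. 0 \<le> b z"
    and "mono b"
    and "\<sigma> > 0"
    and "continuous_on UNIV u0" "bounded (range u0)" "\<And>x. 0 \<le> u0 x"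
    and "continuous_on UNIV v0" "bounded (range v0)" "\<And>x. 0 \<le> v0 x"
    and "\<alpha> > 0" "\<beta> > 0"
    and "(\<integral>\<^sup>+s\<in>{\<alpha>..}. 1 / ennreal (sqrt (\<beta>\<^sup>2 + 2 * (LINT r:{\<alpha>..s}|lborel. b r))) \<partial>lborel) < \<infinity>"
    and "local_solution M F W \<sigma> b u0 v0 \<tau> u"
  shows "AE \<omega> in M. \<tau> \<omega> < \<infinity>"
proof -
  note nonneg = assms(4) and mono = assms(5) and pos = assms(13,14) and int = assms(15)
  interpret wave_solution M F W b u0 v0 \<sigma> \<tau> u
    using assms(1,2,4-7,9,12,16) by unfold_locales
  obtain k where k: "0 < b (2 ^ k)"
    using osgood_positive[OF nonneg mono pos int] by (rule exE)
  show ?thesis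
    by (rule no_global_solution[OF osgood_summable[OF nonneg mono pos int] k])
qed

end
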